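(* Let $k\ge 1$ and let $n_1,\dots,n_k$ be positive integers. If $n_1=n_2=\dots=n_k=1$, then $\text{sat}^*(n,K_{n_1,\dots,n_k})=O(1)$. Otherwise, $\text{sat}^*(n,K_{n_1,\dots,n_k})=\Theta(n)$. (Asymptotics are as $n\to\infty$ with $k,n_1,\dots,n_k$ fixed.)
   Context: $[n]=\{1,\dots,n\}$, and families of subsets of $[n]$ are ordered by inclusion. A poset $(\mathcal Q,\preceq)$ contains an induced copy of a poset $(\mathcal P,\preceq')$ if there is an injective order-preserving function $f:\mathcal P\to\mathcal Q$ such that $(f(\mathcal P),\preceq)$ is isomorphic to $(\mathcal P,\preceq')$. For a finite poset $\mathcal P$, a family $\mathcal F$ of subsets of $[n]$ is $\mathcal P$-saturated if $\mathcal F$ contains no induced copy of $\mathcal P$ and, for every subset $S\subseteq[n]$ with $S\notin\mathcal F$, the family $\mathcal F\cup\{S\}$ contains an induced copy of $\mathcal P$. The induced saturation number $\text{sat}^*(n,\mathcal P)$ is the smallest size of a $\mathcal P$-saturated family of subsets of $[n]$. $K_{n_1,\dots,n_k}$ denotes the complete multipartite poset with $k$ layers of sizes $n_1,\dots,n_k$, in this order, where $n_1$ is the size of the bottom layer: each layer is an antichain, and every element of a higher layer is strictly greater than every element of a lower layer. *)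

theory Defs
  imports Main "HOL-Library.FuncSet" "HOL-Library.Landau_Symbols"
begin

text \<open>A poset is given by a carrier set together with an order relation on it.\<close>

definition posets_isomorphic ::
    "'a set \<Rightarrow> ('a \<Rightarrow> 'a \<Rightarrow> bool) \<Rightarrow> 'b set \<Rightarrow> ('b \<Rightarrow> 'b \<Rightarrow> bool) \<Rightarrow> bool" where
  "posets_isomorphic A r B s \<longleftrightarrow>
     (\<exists>g. bij_betw g A B \<and> (\<forall>x\<in>A. \<forall>y\<in>A. r x y \<longleftrightarrow> s (g x) (g y)))"

definition contains_induced_copy ::
    "'b set \<Rightarrow> ('b \<Rightarrow> 'b \<Rightarrow> bool) \<Rightarrow> 'a set \<Rightarrow> ('a \<Rightarrow> 'a \<Rightarrow> bool) \<Rightarrow> bool" where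
  "contains_induced_copy Q s P r \<longleftrightarrow>
     (\<exists>f\<in>P \<rightarrow> Q. inj_on f P \<and> monotone_on P r s f \<and> posets_isomorphic (f ` P) s P r)"

definition saturated ::
    "nat \<Rightarrow> 'a set \<Rightarrow> ('a \<Rightarrow> 'a \<Rightarrow> bool) \<Rightarrow> nat set set \<Rightarrow> bool" where
  "saturated n P r F \<longleftrightarrow>
     F \<subseteq> Pow {1..n} \<and>
     \<not> contains_induced_copy F (\<subseteq>) P r \<and>
     (\<forall>S. S \<subseteq> {1..n} \<and> S \<notin> F \<longrightarrow> contains_induced_copy (insert S F) (\<subseteq>) P r)"

text \<open>The minimum is over a nonempty set whenever \<open>P\<close> is nonempty;
  see \<open>saturated_exists\<close> below.\<close>

definition sat_star :: "nat \<Rightarrow> 'a set \<Rightarrow> ('a \<Rightarrow> 'a \<Rightarrow> bool) \<Rightarrow> nat" where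
  "sat_star n P r = (LEAST m. \<exists>F. saturated n P r F \<and> card F = m)"

text \<open>The element \<open>(i, j)\<close> is the \<open>j\<close>-th element of layer \<open>i\<close>, where layer 1 is the bottom one.\<close>

definition multipartite_carrier :: "nat \<Rightarrow> (nat \<Rightarrow> nat) \<Rightarrow> (nat \<times> nat) set" where
  "multipartite_carrier k ns = (SIGMA i:{1..k}. {1..ns i})"

definition multipartite_le :: "nat \<times> nat \<Rightarrow> nat \<times> nat \<Rightarrow> bool" where
  "multipartite_le x y \<longleftrightarrow> x = y \<or> fst x < fst y"

abbreviation sat_star_multipartite :: "nat \<Rightarrow> nat \<Rightarrow> (nat \<Rightarrow> nat) \<Rightarrow> nat" where
  "sat_star_multipartite n k ns \<equiv> sat_star n (multipartite_carrier k ns) multipartite_le"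

lemma partial_order_multipartite:
  "partial_order_on UNIV {(x, y). multipartite_le x y}"
  by (auto simp: partial_order_on_def preorder_on_def refl_on_def trans_def antisym_def
      multipartite_le_def)

lemma saturated_exists:
  assumes "P \<noteq> {}"
  shows "\<exists>F. saturated n P r F"
proof -
  let ?X = "{F. F \<subseteq> Pow {1..n} \<and> \<not> contains_induced_copy F (\<subseteq>) P r}"
  have "finite ?X"
    by (rule finite_subset[of _ "Pow (Pow {1..n})"]) auto
  moreover have "{} \<in> ?X"
    using assms by (auto simp: contains_induced_copy_def)
  ultimately have "\<exists>F\<in>?X. \<forall>G\<in>?X. F \<subseteq> G \<longrightarrow> F = G"
    by (intro finite_has_maximal) auto
  then obtain F where F: "F \<in> ?X" and max: "\<forall>G\<in>?X. F \<subseteq> G \<longrightarrow> F = G"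
    by (rule bexE)
  have "contains_induced_copy (insert S F) (\<subseteq>) P r" if S: "S \<subseteq> {1..n}" "S \<notin> F" for S
  proof (rule ccontr)
    assume "\<not> contains_induced_copy (insert S F) (\<subseteq>) P r"
    with F S(1) have "insert S F \<in> ?X"
      by simp
    from max[rule_format, OF this subset_insertI] have "S \<in> F"
      by (rule ssubst) (rule insertI1)
    with S(2) show False ..
  qed
  with F have "saturated n P r F"
    by (simp add: saturated_def)
  then show ?thesis ..
qed

end

theory Submission
  imports Defs
begin

text \<open>
  A copy of the complete multipartite poset in a family is a \<^emph>\<open>stack\<close>: one antichain of the
  prescribed size for each layer, every member of a higher layer properly containing every member
  of a lower one. Two estimates of saturated families carry the theorem.

  \<^emph>\<open>Lower bound\<close> (\<open>saturated_card_ge\<close>). Let layer \<open>m\<close> have at least two elements, and suppose that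
  a saturated family \<open>F\<close> on \<open>n\<close> points has fewer than \<open>n - 1\<close> members. By linear algebra some
  nonzero real weight \<open>x\<close> on the points sums to 0 over the whole ground set and over every member
  of \<open>F\<close>. Let \<open>P\<close> and \<open>N\<close> be the points of positive and of negative weight. A member of \<open>F\<close> that
  avoids one of \<open>P\<close>, \<open>N\<close> avoids both, and a member that contains one of them contains both. So a
  set \<open>X\<close> that contains \<open>P\<close> and avoids \<open>N\<close> is not in \<open>F\<close>, and adding it creates a stack; the
  members of \<open>F\<close> below \<open>X\<close> avoid \<open>P \<union> N\<close> and those above \<open>X\<close> contain \<open>P \<union> N\<close>. Hence layers
  of \<open>F\<close> that lie below \<open>X \<union> N\<close> can be replaced by layers inside \<open>X - P\<close> (\<open>push_down\<close>), as
  otherwise they could be glued to the layers above \<open>X\<close>.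

  Call \<open>B\<close> in \<open>F\<close> a \<^emph>\<open>slot\<close> if \<open>F\<close> has the layers below \<open>m\<close> beneath \<open>B\<close> and the layers above \<open>m\<close>
  over \<open>B\<close>. If \<open>B\<close> does not contain \<open>P \<union> N\<close>, then \<open>X = B \<union> P\<close> is not in \<open>F\<close> because its
  weight is positive; otherwise \<open>X = B - N\<close> is not in \<open>F\<close>. The new stack has \<open>X\<close> in layer \<open>m\<close>, and
  exchanging \<open>X\<close> for \<open>B\<close> would give a stack in \<open>F\<close> unless another
  member \<open>D\<close> of that layer is comparable to \<open>B\<close> (\<open>slot_neighbour\<close>). As \<open>D\<close> is a slot that is incomparable to \<open>X\<close>, it lies above \<open>B\<close> and fails to contain \<open>P \<union> N\<close> in the
  first case, and lies below \<open>B\<close> in the second. A maximal slot among those not containing \<open>P \<union> N\<close>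
  excludes the first case, and then a minimal slot excludes the second.

  \<^emph>\<open>Upper bound\<close> (\<open>sat_star_multipartite_le\<close>). Fix a constant number of points \<open>T 0\<close> and treat the
  block \<open>R\<close> of all other points as one atom. There is a stack-free \<^emph>\<open>skeleton\<close> of sets that do not
  split \<open>R\<close> such that every \<open>A \<subseteq> T 0\<close> has a level \<open>m\<close>: the skeleton contains layers \<open>1,\<dots>,m-1\<close>
  inside \<open>A\<close> and layers \<open>m+1,\<dots>,k\<close> over \<open>A \<union> R\<close> (\<open>level_exists\<close>). Extend the skeleton to a saturated
  family. Its members with trace \<open>A\<close> on \<open>T 0\<close> that split \<open>R\<close> fit between these layers, so they
  contain no antichain as large as layer \<open>m\<close>; sorted by cardinality, there are at most
  \<open>(n + 1) (w - 1)\<close> of them if \<open>w\<close> bounds all layer sizes. The number of traces is constant, so the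
  family has linear size, and bounded size if \<open>w = 1\<close>.
\<close>

section \<open>Stacks of antichains\<close>

definition sperner :: "nat set set \<Rightarrow> bool" where
  "sperner \<A> \<longleftrightarrow> (\<forall>x\<in>\<A>. \<forall>y\<in>\<A>. x \<subseteq> y \<longrightarrow> x = y)"

text \<open>
  The layers are kept as sets \<open>\<Lambda> i\<close> rather than as the image of the carrier: parts of different
  stacks can then be glued without choosing enumerations. The index set \<open>I\<close> allows stacks that
  have only the lower or only the upper layers.
\<close>
definition stack :: "(nat \<Rightarrow> nat) \<Rightarrow> nat set \<Rightarrow> nat set set \<Rightarrow> (nat \<Rightarrow> nat set set) \<Rightarrow> bool" where
  "stack ns I F \<Lambda> \<longleftrightarrow>
     (\<forall>i\<in>I. \<Lambda> i \<subseteq> F \<and> finite (\<Lambda> i) \<and> card (\<Lambda> i) = ns i \<and> sperner (\<Lambda> i)) \<and>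
     (\<forall>i\<in>I. \<forall>j\<in>I. i < j \<longrightarrow> (\<forall>x\<in>\<Lambda> i. \<forall>y\<in>\<Lambda> j. x \<subset> y))"

lemma stackD:
  assumes "stack ns I F \<Lambda>" "i \<in> I"
  shows "\<Lambda> i \<subseteq> F" "finite (\<Lambda> i)" "card (\<Lambda> i) = ns i" "sperner (\<Lambda> i)"
  using assms by (auto simp: stack_def)

lemma stack_psubset:
  "stack ns I F \<Lambda> \<Longrightarrow> i \<in> I \<Longrightarrow> j \<in> I \<Longrightarrow> i < j \<Longrightarrow> x \<in> \<Lambda> i \<Longrightarrow> y \<in> \<Lambda> j \<Longrightarrow> x \<subset> y"
  by (auto simp: stack_def)

lemma stack_restrict: "stack ns I F \<Lambda> \<Longrightarrow> J \<subseteq> I \<Longrightarrow> stack ns J F \<Lambda>"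
  unfolding stack_def by (meson subsetD)

lemma stack_within: "stack ns I F \<Lambda> \<Longrightarrow> (\<And>i. i \<in> I \<Longrightarrow> \<Lambda> i \<subseteq> G) \<Longrightarrow> stack ns I G \<Lambda>"
  unfolding stack_def by blast

lemma stack_join:
  assumes \<Lambda>: "stack ns {1..m} F \<Lambda>" and M: "stack ns {m<..k} F M"
    and cross: "\<And>i j x y. i \<in> {1..m} \<Longrightarrow> j \<in> {m<..k} \<Longrightarrow> x \<in> \<Lambda> i \<Longrightarrow> y \<in> M j \<Longrightarrow> x \<subset> y"
  shows "\<exists>\<Omega>. stack ns {1..k} F \<Omega>"
proof
  let ?\<Omega> = "\<lambda>i. if i \<le> m then \<Lambda> i else M i"
  show "stack ns {1..k} F ?\<Omega>"
    unfolding stack_def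
  proof (rule conjI)
    show "\<forall>i\<in>{1..k}. ?\<Omega> i \<subseteq> F \<and> finite (?\<Omega> i) \<and> card (?\<Omega> i) = ns i \<and> sperner (?\<Omega> i)"
      using stackD[OF \<Lambda>] stackD[OF M] by simp
    show "\<forall>i\<in>{1..k}. \<forall>j\<in>{1..k}. i < j \<longrightarrow> (\<forall>x\<in>?\<Omega> i. \<forall>y\<in>?\<Omega> j. x \<subset> y)"
    proof (intro ballI impI)
      fix i j x y
      assume "i \<in> {1..k}" "j \<in> {1..k}" "i < j" "x \<in> ?\<Omega> i" "y \<in> ?\<Omega> j"
      then show "x \<subset> y"
        using stack_psubset[OF \<Lambda>, of i j x y] stack_psubset[OF M, of i j x y] cross[of i j x y]
        by (simp split: if_splits)
    qed
  qed
qed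

lemma stack_add_layer:
  assumes \<Lambda>: "stack ns I F \<Lambda>" and m: "m \<notin> I"
    and \<D>: "\<D> \<subseteq> F" "finite \<D>" "card \<D> = ns m" "sperner \<D>"
    and lower: "\<And>i x d. i \<in> I \<Longrightarrow> i < m \<Longrightarrow> x \<in> \<Lambda> i \<Longrightarrow> d \<in> \<D> \<Longrightarrow> x \<subset> d"
    and upper: "\<And>i d y. i \<in> I \<Longrightarrow> m < i \<Longrightarrow> d \<in> \<D> \<Longrightarrow> y \<in> \<Lambda> i \<Longrightarrow> d \<subset> y"
  shows "stack ns (insert m I) F (\<Lambda>(m := \<D>))"
  unfolding stack_def
proof (intro conjI ballI impI)
  fix i j x y
  assume ij: "i \<in> insert m I" "j \<in> insert m I" "i < j"
    and xy: "x \<in> (\<Lambda>(m := \<D>)) i" "y \<in> (\<Lambda>(m := \<D>)) j"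
  show "x \<subset> y"
  proof (cases "i = m")
    case True
    then show ?thesis using ij xy upper[of j x y] by simp
  next
    case False
    show ?thesis
    proof (cases "j = m")
      case True
      then show ?thesis using ij xy lower[of i x y] \<open>i \<noteq> m\<close> by simp
    next
      case False
      then show ?thesis using ij xy \<open>i \<noteq> m\<close> stack_psubset[OF \<Lambda>, of i j x y] by simp
    qed
  qed
qed (use stackD[OF \<Lambda>] \<D> in \<open>auto split: if_splits\<close>)

text \<open>
  Layer \<open>m\<close> need only fit between the other two parts: it is nonempty, so it also puts the lower
  part below the upper part.
\<close>
lemma stack_sandwich:
  assumes "stack ns {1..<m} F \<Lambda>" "stack ns {m<..k} F M" "m \<in> {1..k}"
    and "\<D> \<subseteq> F" "finite \<D>" "card \<D> = ns m" "sperner \<D>" "\<D> \<noteq> {}"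
    and lower: "\<And>i x d. i \<in> {1..<m} \<Longrightarrow> x \<in> \<Lambda> i \<Longrightarrow> d \<in> \<D> \<Longrightarrow> x \<subset> d"
    and upper: "\<And>j d y. j \<in> {m<..k} \<Longrightarrow> d \<in> \<D> \<Longrightarrow> y \<in> M j \<Longrightarrow> d \<subset> y"
  shows "\<exists>\<Omega>. stack ns {1..k} F \<Omega>"
proof (rule stack_join)
  have "stack ns (insert m {1..<m}) F (\<Lambda>(m := \<D>))"
    using assms(1,4-7) lower by (intro stack_add_layer) auto
  moreover have "insert m {1..<m} = {1..m}" using assms(3) by auto
  ultimately show "stack ns {1..m} F (\<Lambda>(m := \<D>))" by simp
  show "stack ns {m<..k} F M" by fact
next
  fix i j x y
  assume "i \<in> {1..m}" and j: "j \<in> {m<..k}" and x: "x \<in> (\<Lambda>(m := \<D>)) i" and y: "y \<in> M j"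
  obtain d where d: "d \<in> \<D>" using \<open>\<D> \<noteq> {}\<close> by blast
  show "x \<subset> y"
  proof (cases "i = m")
    case True
    with x upper[OF j _ y] show ?thesis by simp
  next
    case False
    with x \<open>i \<in> {1..m}\<close> have "x \<subset> d" using lower[of i x d] d by simp
    also have "d \<subset> y" using upper[OF j d y] .
    finally show ?thesis .
  qed
qed

text \<open>
  The preimages of the layers under an isomorphism form a stack. Conversely, any enumeration of
  the layers is an isomorphism, because strict order between elements depends on the layers only.
\<close>
lemma contains_copy_iff_stack:
  "contains_induced_copy F (\<subseteq>) (multipartite_carrier k ns) multipartite_le
     \<longleftrightarrow> (\<exists>\<Lambda>. stack ns {1..k} F \<Lambda>)" (is "?copy \<longleftrightarrow> ?stack")
proof
  let ?P = "multipartite_carrier k ns"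
  assume ?copy
  then obtain f g where f: "f \<in> ?P \<rightarrow> F" and g: "bij_betw g (f ` ?P) ?P"
    and iso: "\<forall>x\<in>f ` ?P. \<forall>y\<in>f ` ?P. x \<subseteq> y \<longleftrightarrow> multipartite_le (g x) (g y)"
    unfolding contains_induced_copy_def posets_isomorphic_def by blast
  let ?Q = "f ` ?P"
  define \<Lambda> where "\<Lambda> i = {x \<in> ?Q. fst (g x) = i}" for i
  have inj: "inj_on g ?Q" and img: "g ` ?Q = ?P"
    using g by (auto simp: bij_betw_def)
  have QF: "?Q \<subseteq> F" using f by auto
  have fin: "finite ?Q" by (simp add: multipartite_carrier_def)
  have card: "card (\<Lambda> i) = ns i" if "i \<in> {1..k}" for i
  proof -
    have "g ` \<Lambda> i = {p \<in> g ` ?Q. fst p = i}" by (auto simp: \<Lambda>_def)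
    also have "\<dots> = {i} \<times> {1..ns i}"
      using that unfolding img by (auto simp: multipartite_carrier_def)
    finally have *: "g ` \<Lambda> i = {i} \<times> {1..ns i}" .
    have "inj_on g (\<Lambda> i)" using inj by (rule inj_on_subset) (auto simp: \<Lambda>_def)
    then have "card (g ` \<Lambda> i) = card (\<Lambda> i)" by (rule card_image)
    with * show ?thesis by (simp add: card_cartesian_product_singleton)
  qed
  have "stack ns {1..k} F \<Lambda>"
    unfolding stack_def sperner_def
  proof (intro conjI ballI impI)
    fix i assume i: "i \<in> {1..k}"
    show "\<Lambda> i \<subseteq> F" using QF by (auto simp: \<Lambda>_def)
    show "finite (\<Lambda> i)" unfolding \<Lambda>_def using fin by simp
    show "card (\<Lambda> i) = ns i" using card i .
    fix x y assume xy: "x \<in> \<Lambda> i" "y \<in> \<Lambda> i" "x \<subseteq> y"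
    then have Q: "x \<in> ?Q" "y \<in> ?Q" and fs: "fst (g x) = fst (g y)" by (auto simp: \<Lambda>_def)
    have "multipartite_le (g x) (g y)" using iso Q xy(3) by blast
    with fs have "g x = g y" by (simp add: multipartite_le_def)
    with inj Q show "x = y" by (meson inj_onD)
  next
    fix i j x y assume "i < j" and xy: "x \<in> \<Lambda> i" "y \<in> \<Lambda> j"
    then have Q: "x \<in> ?Q" "y \<in> ?Q" and fs: "fst (g x) < fst (g y)" by (auto simp: \<Lambda>_def)
    have "x \<subseteq> y" using iso Q fs by (auto simp: multipartite_le_def)
    with fs show "x \<subset> y" by auto
  qed
  then show ?stack by blast
next
  let ?P = "multipartite_carrier k ns"
  assume ?stack
  then obtain \<Lambda> where \<Lambda>: "stack ns {1..k} F \<Lambda>" by blast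
  have "\<exists>b. bij_betw b {1..ns i} (\<Lambda> i)" if "i \<in> {1..k}" for i
    using ex_bij_betw_nat_finite_1[OF stackD(2)[OF \<Lambda> that]] stackD(3)[OF \<Lambda> that] by simp
  then obtain b where b: "\<And>i. i \<in> {1..k} \<Longrightarrow> bij_betw (b i) {1..ns i} (\<Lambda> i)" by metis
  define f where "f = (\<lambda>p. b (fst p) (snd p))"
  have fp: "fst p \<in> {1..k}" and sp: "snd p \<in> {1..ns (fst p)}" if "p \<in> ?P" for p
    using that by (auto simp: multipartite_carrier_def)
  have mem: "f p \<in> \<Lambda> (fst p)" if "p \<in> ?P" for p
    unfolding f_def using bij_betw_apply[OF b[OF fp[OF that]] sp[OF that]] .
  have le: "f p \<subseteq> f q \<longleftrightarrow> multipartite_le p q" if pq: "p \<in> ?P" "q \<in> ?P" for p q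
  proof (cases "fst p" "fst q" rule: linorder_cases)
    case less
    then show ?thesis
      using stack_psubset[OF \<Lambda> fp[OF pq(1)] fp[OF pq(2)] less mem[OF pq(1)] mem[OF pq(2)]]
      by (auto simp: multipartite_le_def)
  next
    case equal
    have "f p \<subseteq> f q \<longleftrightarrow> f p = f q"
      using stackD(4)[OF \<Lambda> fp[OF pq(1)]] mem[OF pq(1)] mem[OF pq(2)] equal
      unfolding sperner_def by auto
    also have "\<dots> \<longleftrightarrow> snd p = snd q"
      using inj_on_eq_iff[OF bij_betw_imp_inj_on[OF b[OF fp[OF pq(1)]]] sp[OF pq(1)]]
        sp[OF pq(2)] equal unfolding f_def by simp
    also have "\<dots> \<longleftrightarrow> p = q" using equal by (simp add: prod_eq_iff)
    finally show ?thesis using equal by (simp add: multipartite_le_def)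
  next
    case greater
    then show ?thesis
      using stack_psubset[OF \<Lambda> fp[OF pq(2)] fp[OF pq(1)] greater mem[OF pq(2)] mem[OF pq(1)]]
      by (auto simp: multipartite_le_def)
  qed
  have inj: "inj_on f ?P"
  proof (rule inj_onI)
    fix p q assume "p \<in> ?P" "q \<in> ?P" "f p = f q"
    then have "multipartite_le p q" "multipartite_le q p" using le by blast+
    then show "p = q" by (auto simp: multipartite_le_def)
  qed
  have "bij_betw (inv_into ?P f) (f ` ?P) ?P"
    by (rule bij_betw_inv_into) (simp add: bij_betw_def inj)
  moreover have "\<forall>x\<in>f ` ?P. \<forall>y\<in>f ` ?P.
      x \<subseteq> y \<longleftrightarrow> multipartite_le (inv_into ?P f x) (inv_into ?P f y)"
    by (simp add: inv_into_f_f[OF inj] le)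
  ultimately have "posets_isomorphic (f ` ?P) (\<subseteq>) ?P multipartite_le"
    unfolding posets_isomorphic_def by blast
  moreover have "f \<in> ?P \<rightarrow> F" using mem fp stackD(1)[OF \<Lambda>] by blast
  moreover have "monotone_on ?P multipartite_le (\<subseteq>) f"
    using le by (auto simp: monotone_on_def)
  ultimately show ?copy
    unfolding contains_induced_copy_def using inj by blast
qed

lemma saturated_multipartite_iff:
  "saturated n (multipartite_carrier k ns) multipartite_le F \<longleftrightarrow>
     F \<subseteq> Pow {1..n} \<and> (\<nexists>\<Lambda>. stack ns {1..k} F \<Lambda>) \<and>
     (\<forall>S. S \<subseteq> {1..n} \<and> S \<notin> F \<longrightarrow> (\<exists>\<Lambda>. stack ns {1..k} (insert S F) \<Lambda>))"
  by (simp add: saturated_def contains_copy_iff_stack)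

text \<open>
  This is how saturation is used: the new set occupies some layer \<open>i\<close>, and all other layers
  consist of old sets, since they are properly comparable to the new one.
\<close>
lemma stack_insertE:
  assumes "stack ns {1..k} (insert X F) \<Lambda>" "\<nexists>\<Lambda>. stack ns {1..k} F \<Lambda>"
  obtains i where "i \<in> {1..k}" "X \<in> \<Lambda> i"
    "stack ns {1..<i} F \<Lambda>" "stack ns {i<..k} F \<Lambda>"
    "\<forall>j\<in>{1..<i}. \<forall>x\<in>\<Lambda> j. x \<subset> X" "\<forall>j\<in>{i<..k}. \<forall>x\<in>\<Lambda> j. X \<subset> x"
proof -
  note sub = stackD(1)[OF assms(1)]
  have "\<exists>i\<in>{1..k}. X \<in> \<Lambda> i"
  proof (rule ccontr)
    assume "\<not> (\<exists>i\<in>{1..k}. X \<in> \<Lambda> i)"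
    then have "stack ns {1..k} F \<Lambda>"
      by (intro stack_within[OF assms(1)]) (use sub in blast)
    with assms(2) show False by blast
  qed
  then obtain i where i: "i \<in> {1..k}" "X \<in> \<Lambda> i" by blast
  have below: "x \<subset> X" if "j \<in> {1..<i}" "x \<in> \<Lambda> j" for j x
    by (rule stack_psubset[OF assms(1) _ i(1) _ that(2) i(2)]) (use that(1) i(1) in auto)
  have above: "X \<subset> x" if "j \<in> {i<..k}" "x \<in> \<Lambda> j" for j x
    by (rule stack_psubset[OF assms(1) i(1) _ _ i(2) that(2)]) (use that(1) i(1) in auto)
  have "stack ns {1..<i} F \<Lambda>"
  proof (rule stack_within)
    show "stack ns {1..<i} (insert X F) \<Lambda>"
      by (rule stack_restrict[OF assms(1)]) (use i in auto)
    show "\<Lambda> j \<subseteq> F" if "j \<in> {1..<i}" for j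
    proof
      fix x assume "x \<in> \<Lambda> j"
      moreover have "j \<in> {1..k}" using that i by auto
      ultimately show "x \<in> F" using sub below[OF that] by blast
    qed
  qed
  moreover have "stack ns {i<..k} F \<Lambda>"
  proof (rule stack_within)
    show "stack ns {i<..k} (insert X F) \<Lambda>"
      by (rule stack_restrict[OF assms(1)]) (use i in auto)
    show "\<Lambda> j \<subseteq> F" if "j \<in> {i<..k}" for j
    proof
      fix x assume "x \<in> \<Lambda> j"
      moreover have "j \<in> {1..k}" using that i by auto
      ultimately show "x \<in> F" using sub above[OF that] by blast
    qed
  qed
  ultimately show thesis using that i below above by blast
qed

section \<open>Saturated families have linearly many members\<close>

text \<open>
  A homogeneous linear system with fewer equations than unknowns has a nonzero solution: one
  equation eliminates one unknown.
\<close>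
lemma nonzero_solution:
  fixes a :: "'j \<Rightarrow> 'i \<Rightarrow> real"
  assumes "finite J" "finite I" "card J < card I"
  shows "\<exists>x. (\<exists>i\<in>I. x i \<noteq> 0) \<and> (\<forall>j\<in>J. (\<Sum>i\<in>I. a j i * x i) = 0)"
  using assms
proof (induction J arbitrary: I a rule: finite_induct)
  case empty
  then obtain i where "i \<in> I" by fastforce
  then show ?case by (intro exI[of _ "\<lambda>_. 1"]) auto
next
  case (insert j J)
  show ?case
  proof (cases "\<forall>i\<in>I. a j i = 0")
    case True
    have "card J < card I" using insert by simp
    with insert.IH[OF insert.prems(1)] obtain x
      where "\<exists>i\<in>I. x i \<noteq> 0" "\<forall>j\<in>J. (\<Sum>i\<in>I. a j i * x i) = 0" by blast
    with True show ?thesis by (intro exI[of _ x]) simp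
  next
    case False
    then obtain p where p: "p \<in> I" "a j p \<noteq> 0" by blast
    \<comment> \<open>Row reduction with pivot \<open>a j p\<close>.\<close>
    define b where "b l i = a l i - a l p * a j i / a j p" for l i
    have "card J < card (I - {p})" using insert p by simp
    then obtain x where x: "\<exists>i\<in>I-{p}. x i \<noteq> 0" "\<forall>l\<in>J. (\<Sum>i\<in>I-{p}. b l i * x i) = 0"
      using insert.IH[of "I - {p}" b] insert.prems by auto
    define y where "y = x(p := - (\<Sum>i\<in>I-{p}. a j i * x i) / a j p)"
    have split: "(\<Sum>i\<in>I. a l i * y i) = (\<Sum>i\<in>I-{p}. a l i * x i) + a l p * y p" for l
    proof -
      have "(\<Sum>i\<in>I. a l i * y i) = a l p * y p + (\<Sum>i\<in>I-{p}. a l i * y i)"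
        using insert.prems p by (simp add: sum.remove)
      also have "(\<Sum>i\<in>I-{p}. a l i * y i) = (\<Sum>i\<in>I-{p}. a l i * x i)"
        by (rule sum.cong) (auto simp: y_def)
      finally show ?thesis by simp
    qed
    have "(\<Sum>i\<in>I. a j i * y i) = 0"
      unfolding split using p by (simp add: y_def)
    moreover have "(\<Sum>i\<in>I. a l i * y i) = 0" if "l \<in> J" for l
    proof -
      have "0 = (\<Sum>i\<in>I-{p}. b l i * x i)" using x that by simp
      also have "\<dots> = (\<Sum>i\<in>I-{p}. a l i * x i - a l p / a j p * (a j i * x i))"
        by (rule sum.cong) (auto simp: b_def field_simps)
      also have "\<dots> = (\<Sum>i\<in>I-{p}. a l i * x i) - a l p / a j p * (\<Sum>i\<in>I-{p}. a j i * x i)"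
        by (simp add: sum_subtractf sum_distrib_left)
      also have "\<dots> = (\<Sum>i\<in>I. a l i * y i)"
        unfolding split by (simp add: y_def)
      finally show ?thesis by simp
    qed
    moreover have "\<exists>i\<in>I. y i \<noteq> 0" using x by (auto simp: y_def)
    ultimately show ?thesis by blast
  qed
qed

text \<open>
  \<open>P\<close> and \<open>N\<close> stand for the points of positive and of negative weight, for a nonzero weight that
  sums to zero over the members of \<open>F\<close> and over the ground set; the last three assumptions are
  the consequences that matter. The contradiction at the end of
  the locale shows that no such weight exists.
\<close>
locale balanced_saturated =
  fixes n k m :: nat and ns :: "nat \<Rightarrow> nat" and F :: "nat set set" and P N :: "nat set"
  assumes saturated: "saturated n (multipartite_carrier k ns) multipartite_le F"
    and m: "m \<in> {1..k}" "ns m \<ge> 2"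
    and P: "P \<noteq> {}" "P \<subseteq> {1..n}" and N: "N \<noteq> {}" "N \<subseteq> {1..n}" and PN: "P \<inter> N = {}"
    and avoid: "A \<in> F \<Longrightarrow> A \<inter> N = {} \<Longrightarrow> A \<inter> P = {}"
    and cover: "A \<in> F \<Longrightarrow> P \<subseteq> A \<longleftrightarrow> N \<subseteq> A"
    and swap: "A \<in> F \<Longrightarrow> A \<union> P \<in> F \<Longrightarrow> P \<subseteq> A"
begin

lemma F_subset: "A \<in> F \<Longrightarrow> A \<subseteq> {1..n}"
  and free: "\<nexists>\<Lambda>. stack ns {1..k} F \<Lambda>"
  and new: "S \<subseteq> {1..n} \<Longrightarrow> S \<notin> F \<Longrightarrow> \<exists>\<Lambda>. stack ns {1..k} (insert S F) \<Lambda>"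
  using saturated unfolding saturated_multipartite_iff by blast+

lemma not_mem_of_split: "A \<inter> N = {} \<Longrightarrow> P \<subseteq> A \<Longrightarrow> A \<notin> F"
  using avoid P by blast

text \<open>
  Take \<open>X\<close> to be \<open>W\<close> with its part in \<open>P \<union> N\<close> replaced by \<open>P\<close>. It is not in \<open>F\<close>, so it sits in some
  layer \<open>i\<close> of a new stack. If \<open>j < i\<close>, the new stack has \<open>j\<close> layers below \<open>X\<close>, and these avoid
  \<open>N\<close>, hence \<open>P\<close>. If \<open>i \<le> j\<close>, the upper layers of the new stack contain \<open>W \<union> P \<union> N\<close>, and
  the layers \<open>1,\<dots>,i\<close> of \<open>\<Lambda>\<close> below them complete a stack in \<open>F\<close>.
\<close>
lemma push_down:
  assumes W: "W \<subseteq> {1..n}" and \<Lambda>: "stack ns {1..j} F \<Lambda>"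
    and sub: "\<And>i x. i \<in> {1..j} \<Longrightarrow> x \<in> \<Lambda> i \<Longrightarrow> x \<subset> W \<union> P \<union> N"
  shows "\<exists>M. stack ns {1..j} F M \<and> (\<forall>i\<in>{1..j}. \<forall>x\<in>M i. x \<subseteq> W - (P \<union> N))"
proof -
  define X where "X = W - (P \<union> N) \<union> P"
  have "X \<notin> F" by (rule not_mem_of_split) (use PN in \<open>auto simp: X_def\<close>)
  moreover have "X \<subseteq> {1..n}" using W P by (auto simp: X_def)
  ultimately obtain M where M: "stack ns {1..k} (insert X F) M" using new by blast
  obtain i where i: "i \<in> {1..k}" "X \<in> M i" "stack ns {1..<i} F M" "stack ns {i<..k} F M"
    and "\<forall>j\<in>{1..<i}. \<forall>x\<in>M j. x \<subset> X" "\<forall>j\<in>{i<..k}. \<forall>x\<in>M j. X \<subset> x"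
    by (rule stack_insertE[OF M free])
  note below = this(5)[rule_format] and above = this(6)[rule_format]
  have "j < i"
  proof (rule ccontr)
    assume "\<not> j < i"
    have "\<exists>\<Omega>. stack ns {1..k} F \<Omega>"
    proof (rule stack_join[OF _ i(4)])
      show "stack ns {1..i} F \<Lambda>" by (rule stack_restrict[OF \<Lambda>]) (use \<open>\<not> j < i\<close> in auto)
      fix a b x y assume a: "a \<in> {1..i}" "b \<in> {i<..k}" "x \<in> \<Lambda> a" "y \<in> M b"
      have "X \<subseteq> y" using above a by blast
      moreover have "y \<in> F" using stackD(1)[OF i(4) a(2)] a by blast
      ultimately have "W \<union> P \<union> N \<subseteq> y" using cover[of y] by (auto simp: X_def)
      moreover have "x \<subset> W \<union> P \<union> N" using sub[of a x] a \<open>\<not> j < i\<close> by auto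
      ultimately show "x \<subset> y" by blast
    qed
    with free show False by blast
  qed
  have "stack ns {1..j} F M"
    by (rule stack_restrict[OF i(3)]) (use \<open>j < i\<close> in auto)
  moreover have "x \<subseteq> W - (P \<union> N)" if x: "a \<in> {1..j}" "x \<in> M a" for a x
  proof -
    have "x \<subset> X" using below[of a x] x \<open>j < i\<close> by auto
    moreover have "x \<in> F" using stackD(1)[OF i(3), of a] x \<open>j < i\<close> by auto
    ultimately show ?thesis using avoid[of x] PN by (auto simp: X_def)
  qed
  ultimately show ?thesis by blast
qed

text \<open>
  Slots are the members of \<open>F\<close> that could serve in layer \<open>m\<close>.
\<close>
definition slot :: "nat set \<Rightarrow> bool" where
  "slot B \<longleftrightarrow> B \<in> F \<and>
     (\<exists>\<Lambda>. stack ns {1..<m} F \<Lambda> \<and> (\<forall>i\<in>{1..<m}. \<forall>x\<in>\<Lambda> i. x \<subset> B)) \<and>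
     (\<exists>\<Lambda>. stack ns {m<..k} F \<Lambda> \<and> (\<forall>i\<in>{m<..k}. \<forall>x\<in>\<Lambda> i. B \<subset> x))"

lemma slot_in_layer:
  assumes X: "X \<notin> F" and \<Lambda>: "stack ns {1..k} (insert X F) \<Lambda>" "X \<in> \<Lambda> m"
    and d: "d \<in> \<Lambda> m" "d \<noteq> X"
  shows "slot d" "\<not> d \<subseteq> X" "\<not> X \<subseteq> d"
proof -
  obtain i where i: "i \<in> {1..k}" "X \<in> \<Lambda> i" "stack ns {1..<i} F \<Lambda>" "stack ns {i<..k} F \<Lambda>"
    by (rule stack_insertE[OF \<Lambda>(1) free])
  have "i = m"
  proof (cases i m rule: linorder_cases)
    case less
    then show ?thesis using stack_psubset[OF \<Lambda>(1) i(1) m(1) less i(2) \<Lambda>(2)] by simp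
  next
    case greater
    then show ?thesis using stack_psubset[OF \<Lambda>(1) m(1) i(1) greater \<Lambda>(2) i(2)] by simp
  qed
  have "d \<in> F" using subsetD[OF stackD(1)[OF \<Lambda>(1) m(1)] d(1)] d(2) by simp
  moreover have "x \<subset> d" if "j \<in> {1..<m}" "x \<in> \<Lambda> j" for j x
    by (rule stack_psubset[OF \<Lambda>(1) _ m(1) _ that(2) d(1)]) (use that(1) m(1) in auto)
  moreover have "d \<subset> x" if "j \<in> {m<..k}" "x \<in> \<Lambda> j" for j x
    by (rule stack_psubset[OF \<Lambda>(1) m(1) _ _ d(1) that(2)]) (use that(1) m(1) in auto)
  moreover have "stack ns {1..<m} F \<Lambda>" "stack ns {m<..k} F \<Lambda>" using i(3,4) \<open>i = m\<close> by simp_all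
  ultimately show "slot d"
    unfolding slot_def by blast
  show "\<not> d \<subseteq> X" "\<not> X \<subseteq> d"
    using stackD(4)[OF \<Lambda>(1) m(1), unfolded sperner_def, rule_format, OF d(1) \<Lambda>(2)]
      stackD(4)[OF \<Lambda>(1) m(1), unfolded sperner_def, rule_format, OF \<Lambda>(2) d(1)] d(2)
    by auto
qed

text \<open>
  The set \<open>X\<close> agrees with \<open>B\<close> outside \<open>P \<union> N\<close>, so every layer over \<open>X\<close> is also over \<open>B\<close>, and every
  layer under \<open>X\<close> can be pushed down under \<open>B\<close>. Therefore \<open>X\<close> can enter a new stack at layer \<open>m\<close>
  only: any other position would give a stack in \<open>F\<close> through the layers around the slot \<open>B\<close>. In
  layer \<open>m\<close>, the same pushing lets \<open>B\<close> replace \<open>X\<close> unless \<open>B\<close> is comparable to another member of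
  that layer.
\<close>
lemma slot_neighbour:
  assumes B: "slot B" and X: "X \<subseteq> {1..n}" "X \<notin> F" "P \<subseteq> X" "\<not> N \<subseteq> X"
    and BX: "X - (P \<union> N) = B - (P \<union> N)" "B \<subseteq> X \<or> X \<subseteq> B"
  shows "\<exists>D. slot D \<and> \<not> D \<subseteq> X \<and> \<not> X \<subseteq> D \<and> (D \<subset> B \<or> B \<subset> D)"
proof -
  obtain \<Lambda> where \<Lambda>: "stack ns {1..k} (insert X F) \<Lambda>" using new X by blast
  obtain i where i: "i \<in> {1..k}" "X \<in> \<Lambda> i" "stack ns {1..<i} F \<Lambda>" "stack ns {i<..k} F \<Lambda>"
    and "\<forall>j\<in>{1..<i}. \<forall>x\<in>\<Lambda> j. x \<subset> X" "\<forall>j\<in>{i<..k}. \<forall>x\<in>\<Lambda> j. X \<subset> x"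
    by (rule stack_insertE[OF \<Lambda> free])
  note below = this(5)[rule_format] and above = this(6)[rule_format]
  obtain L U where "B \<in> F"
    and L: "stack ns {1..<m} F L" "\<forall>j\<in>{1..<m}. \<forall>x\<in>L j. x \<subset> B"
    and U: "stack ns {m<..k} F U" "\<forall>j\<in>{m<..k}. \<forall>x\<in>U j. B \<subset> x"
    using B unfolding slot_def by blast
  have above_B: "B \<subseteq> x" if "j \<in> {i<..k}" "x \<in> \<Lambda> j" for j x
  proof -
    have "x \<in> F" using stackD(1)[OF i(4) that(1)] that(2) by blast
    then have "N \<subseteq> x" using cover[of x] above[OF that] X(3) by blast
    then show ?thesis using above[OF that] X(3) BX(1) by blast
  qed
  have "\<not> i < m"
  proof
    assume "i < m"
    have "\<exists>\<Omega>. stack ns {1..k} F \<Omega>"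
    proof (rule stack_join[OF _ i(4)])
      show "stack ns {1..i} F L" by (rule stack_restrict[OF L(1)]) (use \<open>i < m\<close> in auto)
      show "x \<subset> y" if "a \<in> {1..i}" "b \<in> {i<..k}" "x \<in> L a" "y \<in> \<Lambda> b" for a b x y
      proof -
        have "a \<in> {1..<m}" using that(1) \<open>i < m\<close> by simp
        then have "x \<subset> B" using L(2) that(3) by blast
        then show ?thesis using above_B[OF that(2,4)] by (rule psubset_subset_trans)
      qed
    qed
    with free show False by blast
  qed
  moreover have "\<not> m < i"
  proof
    assume "m < i"
    have "stack ns {1..m} F \<Lambda>" by (rule stack_restrict[OF i(3)]) (use \<open>m < i\<close> in auto)
    moreover have "x \<subset> X \<union> P \<union> N" if "a \<in> {1..m}" "x \<in> \<Lambda> a" for a x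
      using below[of a x] that \<open>m < i\<close> by auto
    ultimately obtain M where M: "stack ns {1..m} F M" "\<forall>a\<in>{1..m}. \<forall>x\<in>M a. x \<subseteq> X - (P \<union> N)"
      using push_down[OF X(1), of m \<Lambda>] by auto
    have "\<exists>\<Omega>. stack ns {1..k} F \<Omega>"
    proof (rule stack_join[OF M(1) U(1)])
      show "x \<subset> y" if "a \<in> {1..m}" "b \<in> {m<..k}" "x \<in> M a" "y \<in> U b" for a b x y
      proof -
        have "x \<subseteq> B" using M(2)[rule_format, OF that(1,3)] BX(1) by blast
        moreover have "B \<subset> y" using U(2) that(2,4) by blast
        ultimately show ?thesis by (rule subset_psubset_trans)
      qed
    qed
    with free show False by blast
  qed
  ultimately have im: "i = m" by simp
  define \<D> where "\<D> = \<Lambda> m - {X}"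
  have Xm: "X \<in> \<Lambda> m" using i im by simp
  have D: "slot d" "\<not> d \<subseteq> X" "\<not> X \<subseteq> d" if "d \<in> \<D>" for d
    using slot_in_layer[OF X(2) \<Lambda> Xm] that unfolding \<D>_def by blast+
  have "finite (\<Lambda> m)" "card (\<Lambda> m) = ns m" using stackD(2,3)[OF \<Lambda> m(1)] .
  then have card: "card \<D> + 1 = ns m" "finite \<D>"
    using Xm m(2) by (auto simp: \<D>_def)
  show ?thesis
  proof (rule ccontr)
    assume "\<nexists>D. slot D \<and> \<not> D \<subseteq> X \<and> \<not> X \<subseteq> D \<and> (D \<subset> B \<or> B \<subset> D)"
    then have "\<not> d \<subset> B \<and> \<not> B \<subset> d" if "d \<in> \<D>" for d using D[OF that] by blast
    moreover have "B \<notin> \<D>" using D(2,3) BX(2) by blast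
    ultimately have incomp: "\<not> d \<subseteq> B" "\<not> B \<subseteq> d" if "d \<in> \<D>" for d using that by blast+
    \<comment> \<open>Pushing below this union, rather than below \<open>X\<close>, keeps the new lower layers below
        the companions of \<open>X\<close> as well.\<close>
    define W where "W = (\<Union>j\<in>{1..<m}. \<Union>(\<Lambda> j))"
    have WX: "W \<subseteq> X" unfolding W_def using below im by blast
    have Wd: "W \<subseteq> d" if "d \<in> \<D>" for d
    proof -
      have "x \<subset> d" if "j \<in> {1..<m}" "x \<in> \<Lambda> j" for j x
        by (rule stack_psubset[OF \<Lambda> _ m(1) _ that(2)]) (use that m(1) \<open>d \<in> \<D>\<close> in \<open>auto simp: \<D>_def\<close>)
      then show ?thesis unfolding W_def by blast
    qed
    have "\<exists>M. stack ns {1..m-1} F M \<and> (\<forall>i\<in>{1..m-1}. \<forall>x\<in>M i. x \<subseteq> W - (P \<union> N))"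
    proof (rule push_down)
      show "W \<subseteq> {1..n}" using WX X(1) by blast
      show "stack ns {1..m-1} F \<Lambda>"
        by (rule stack_restrict[OF i(3)]) (use im in auto)
      show "x \<subset> W \<union> P \<union> N" if "j \<in> {1..m-1}" "x \<in> \<Lambda> j" for j x
      proof -
        have "j \<in> {1..<m}" using that(1) m(1) by auto
        then have "x \<subseteq> W" unfolding W_def using that(2) by blast
        then show ?thesis using WX X(4) by blast
      qed
    qed
    moreover have "{1..m-1} = {1..<m}" by auto
    ultimately obtain M where M: "stack ns {1..<m} F M"
      "\<forall>j\<in>{1..<m}. \<forall>x\<in>M j. x \<subseteq> W - (P \<union> N)" by auto
    obtain d0 where d0: "d0 \<in> \<D>" using card m(2) by fastforce
    have "\<exists>\<Omega>. stack ns {1..k} F \<Omega>"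
    proof (rule stack_sandwich[OF M(1) _ m(1)])
      show "stack ns {m<..k} F \<Lambda>" using i(4) im by simp
      show "insert B \<D> \<subseteq> F"
        using \<open>B \<in> F\<close> D(1) by (auto simp: slot_def)
      show "finite (insert B \<D>)" "insert B \<D> \<noteq> {}" using card by auto
      show "card (insert B \<D>) = ns m" using card \<open>B \<notin> \<D>\<close> by simp
      show "sperner (insert B \<D>)"
        unfolding sperner_def
      proof (intro ballI impI)
        fix u v assume "u \<in> insert B \<D>" "v \<in> insert B \<D>" "u \<subseteq> v"
        moreover have "u = v" if "u \<in> \<D>" "v \<in> \<D>"
          using stackD(4)[OF \<Lambda> m(1)] that \<open>u \<subseteq> v\<close> unfolding sperner_def \<D>_def by simp
        ultimately show "u = v" using incomp by auto
      qed
    next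
      fix j x d assume x: "j \<in> {1..<m}" "x \<in> M j" and d: "d \<in> insert B \<D>"
      have xX: "x \<subseteq> X" "x \<subseteq> B" "x \<subseteq> W" using M(2)[rule_format, OF x] WX BX(1) by blast+
      show "x \<subset> d"
      proof (cases "d = B")
        case True
        then show ?thesis using xX Wd[OF d0] incomp[OF d0] by blast
      next
        case False
        then have "d \<in> \<D>" using d by blast
        then show ?thesis using xX Wd[of d] D(2)[of d] by blast
      qed
    next
      fix j d y assume y: "j \<in> {m<..k}" "y \<in> \<Lambda> j" and d: "d \<in> insert B \<D>"
      have *: "e \<subset> y" if "e \<in> \<D>" for e
        by (rule stack_psubset[OF \<Lambda> m(1) _ _ _ y(2)]) (use y(1) that m(1) in \<open>auto simp: \<D>_def\<close>)
      have "B \<subseteq> y" using above_B[of j y] y im by simp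
      then show "d \<subset> y" using * d d0 incomp[OF d0] by blast
    qed
    with free show False by blast
  qed
qed

text \<open>
  Let \<open>Z\<close> be a maximal set outside \<open>P \<union> N\<close> such that \<open>Z \<union> P\<close> has no \<open>m\<close> layers below it. Then
  \<open>X = Z \<union> P\<close> sits in layer \<open>m\<close> of the stack that it creates, and its companions in that layer are
  slots: a position above \<open>m\<close> is excluded by the choice of \<open>Z\<close>, and if \<open>X\<close> sat lower,
  a member of layer \<open>m\<close> would properly contain \<open>X \<union> N\<close>, hence have \<open>m\<close> layers inside it by
  maximality, below the layers after \<open>m\<close>.
\<close>
lemma slot_exists: "\<exists>B. slot B"
proof -
  define bad where "bad Z \<longleftrightarrow> (\<exists>\<Lambda>. stack ns {1..m} F \<Lambda> \<and> (\<forall>i\<in>{1..m}. \<forall>x\<in>\<Lambda> i. x \<subset> Z \<union> P))" for Z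
  define \<Z> where "\<Z> = {Z. Z \<subseteq> {1..n} - (P \<union> N) \<and> \<not> bad Z}"
  have two: "\<exists>x\<in>\<Lambda> m. \<exists>y\<in>\<Lambda> m. \<not> x \<subseteq> y" if "stack ns I G \<Lambda>" "m \<in> I" for I G \<Lambda>
  proof -
    have "card (\<Lambda> m) \<ge> 2" "finite (\<Lambda> m)" using stackD(2,3)[OF that] m(2) by auto
    then obtain x y where "x \<in> \<Lambda> m" "y \<in> \<Lambda> m" "x \<noteq> y"
      by (metis card_le_Suc0_iff_eq not_less_eq_eq numeral_2_eq_2)
    then show ?thesis using stackD(4)[OF that] unfolding sperner_def by blast
  qed
  have inside: "x \<subseteq> Z" if "x \<in> F" "x \<subset> Z \<union> P" "Z \<inter> N = {}" for x Z
    using avoid[OF that(1)] that PN by blast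
  have "\<not> bad {}"
  proof
    assume "bad {}"
    then obtain \<Lambda> where \<Lambda>: "stack ns {1..m} F \<Lambda>" "\<forall>i\<in>{1..m}. \<forall>x\<in>\<Lambda> i. x \<subset> {} \<union> P"
      unfolding bad_def by blast
    have "m \<in> {1..m}" using m by simp
    have "x = {}" if "x \<in> \<Lambda> m" for x
      using inside[of x "{}"] \<Lambda>(2) stackD(1)[OF \<Lambda>(1) \<open>m \<in> {1..m}\<close>] that \<open>m \<in> {1..m}\<close> by blast
    then show False using two[OF \<Lambda>(1) \<open>m \<in> {1..m}\<close>] by blast
  qed
  then have "{} \<in> \<Z>" by (simp add: \<Z>_def)
  moreover have "finite \<Z>"
    by (rule finite_subset[of _ "Pow {1..n}"]) (auto simp: \<Z>_def)
  ultimately obtain Z where Z: "Z \<in> \<Z>" and max: "\<forall>Y\<in>\<Z>. Z \<subseteq> Y \<longrightarrow> Z = Y"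
    using finite_has_maximal[of \<Z>] by blast
  define X where "X = Z \<union> P"
  have Zsub: "Z \<subseteq> {1..n} - (P \<union> N)" "\<not> bad Z" using Z by (auto simp: \<Z>_def)
  have XF: "X \<notin> F" by (rule not_mem_of_split) (use PN Zsub in \<open>auto simp: X_def\<close>)
  have "X \<subseteq> {1..n}" using Zsub P by (auto simp: X_def)
  then obtain \<Lambda> where \<Lambda>: "stack ns {1..k} (insert X F) \<Lambda>" using new XF by blast
  obtain i where i: "i \<in> {1..k}" "X \<in> \<Lambda> i" "stack ns {1..<i} F \<Lambda>" "stack ns {i<..k} F \<Lambda>"
    and "\<forall>j\<in>{1..<i}. \<forall>x\<in>\<Lambda> j. x \<subset> X" "\<forall>j\<in>{i<..k}. \<forall>x\<in>\<Lambda> j. X \<subset> x"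
    by (rule stack_insertE[OF \<Lambda> free])
  note below = this(5)[rule_format] and above = this(6)[rule_format]
  have "\<not> m < i"
  proof
    assume "m < i"
    then have "stack ns {1..m} F \<Lambda>" by (intro stack_restrict[OF i(3)]) auto
    moreover have "\<forall>a\<in>{1..m}. \<forall>x\<in>\<Lambda> a. x \<subset> Z \<union> P"
    proof (intro ballI)
      fix a x assume "a \<in> {1..m}" "x \<in> \<Lambda> a"
      moreover from this have "a \<in> {1..<i}" using \<open>m < i\<close> by simp
      ultimately show "x \<subset> Z \<union> P" unfolding X_def[symmetric] using below by blast
    qed
    ultimately show False using Zsub(2) unfolding bad_def by blast
  qed
  moreover have "\<not> i < m"
  proof
    assume "i < m"
    then have mi: "m \<in> {i<..k}" using m by simp
    obtain d e where de: "d \<in> \<Lambda> m" "e \<in> \<Lambda> m" "\<not> d \<subseteq> e" using two[OF i(4) mi] by blast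
    have dF: "d \<in> F" "e \<in> F" using stackD(1)[OF i(4) mi] de by auto
    have "X \<subseteq> d" "X \<subseteq> e" using above[OF mi] de by blast+
    then have dX: "X \<union> N \<subseteq> d" "X \<union> N \<subseteq> e" using cover dF by (auto simp: X_def)
    then obtain z where z: "z \<in> d" "z \<notin> X \<union> N" using de(3) by blast
    have "bad (insert z Z)"
    proof (rule ccontr)
      assume "\<not> bad (insert z Z)"
      then have "insert z Z \<in> \<Z>"
        using Zsub z F_subset[OF dF(1)] by (auto simp: \<Z>_def X_def)
      then show False using max z by (auto simp: X_def)
    qed
    then obtain M where M: "stack ns {1..m} F M" "\<forall>i\<in>{1..m}. \<forall>x\<in>M i. x \<subset> insert z Z \<union> P"
      unfolding bad_def by blast
    have Md: "x \<subseteq> d" if "a \<in> {1..m}" "x \<in> M a" for a x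
    proof -
      have "x \<subseteq> insert z Z"
        by (rule inside) (use M stackD(1)[OF M(1) that(1)] that z Zsub in auto)
      then show ?thesis using z dX by (auto simp: X_def)
    qed
    have "\<exists>\<Omega>. stack ns {1..k} F \<Omega>"
    proof (rule stack_join[OF M(1)])
      show "stack ns {m<..k} F \<Lambda>" by (rule stack_restrict[OF i(4)]) (use \<open>i < m\<close> in auto)
      show "x \<subset> y" if "a \<in> {1..m}" "b \<in> {m<..k}" "x \<in> M a" "y \<in> \<Lambda> b" for a b x y
        using Md[OF that(1,3)] stack_psubset[OF i(4) mi, of b d y] that de(1) \<open>i < m\<close> by auto
    qed
    with free show False by blast
  qed
  ultimately have "X \<in> \<Lambda> m" using i(2) by (simp add: not_less_iff_gr_or_eq)
  moreover obtain d where "d \<in> \<Lambda> m" "d \<noteq> X" using two[OF \<Lambda> m(1)] by blast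
  ultimately show ?thesis using slot_in_layer(1)[OF XF \<Lambda>] by blast
qed

lemma contradiction: False
proof -
  have fin: "finite {B. slot B}"
    by (rule finite_subset[of _ "Pow {1..n}"]) (use F_subset in \<open>auto simp: slot_def\<close>)
  \<comment> \<open>A maximal counterexample \<open>C\<close> would have a slot \<open>D\<close> above it that does not contain \<open>P\<close> either.\<close>
  have full: "P \<union> N \<subseteq> B" if "slot B" for B
  proof (rule ccontr)
    let ?\<S> = "{B. slot B \<and> \<not> P \<union> N \<subseteq> B}"
    assume "\<not> P \<union> N \<subseteq> B"
    with that have "B \<in> ?\<S>" by blast
    then have "?\<S> \<noteq> {}" by blast
    moreover have "finite ?\<S>" using fin by (rule rev_finite_subset) blast
    ultimately obtain C where C: "C \<in> ?\<S>" and max: "\<forall>D\<in>?\<S>. C \<subseteq> D \<longrightarrow> C = D"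
      using finite_has_maximal[of ?\<S>] by blast
    have CF: "C \<in> F" using C by (simp add: slot_def)
    have PC: "\<not> P \<subseteq> C" "\<not> N \<subseteq> C" using C cover[OF CF] by auto
    have "C \<union> P \<notin> F" using swap[OF CF] PC by blast
    moreover have "C \<union> P \<subseteq> {1..n}" using F_subset[OF CF] P by blast
    moreover have "\<not> N \<subseteq> C \<union> P" using PC PN by blast
    ultimately obtain D where D: "slot D" "\<not> D \<subseteq> C \<union> P" "\<not> C \<union> P \<subseteq> D" "D \<subset> C \<or> C \<subset> D"
      using slot_neighbour[of C "C \<union> P"] C by blast
    then have "C \<subset> D" by blast
    then have "P \<union> N \<subseteq> D" using max D(1) by blast
    with D(3) \<open>C \<subset> D\<close> show False by blast
  qed
  have "{B. slot B} \<noteq> {}" using slot_exists by blast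
  then obtain B where B: "slot B" and min: "\<forall>D\<in>{B. slot B}. D \<subseteq> B \<longrightarrow> B = D"
    using finite_has_minimal[OF fin] by blast
  have BF: "B \<in> F" using B by (simp add: slot_def)
  have "B - N \<notin> F" by (rule not_mem_of_split) (use full[OF B] PN in auto)
  moreover have "B - N \<subseteq> {1..n}" using F_subset[OF BF] by blast
  moreover have "P \<subseteq> B - N" "\<not> N \<subseteq> B - N" using full[OF B] PN N(1) by auto
  moreover have "B - N - (P \<union> N) = B - (P \<union> N)" by blast
  ultimately obtain D where D: "slot D" "\<not> B - N \<subseteq> D" "D \<subset> B \<or> B \<subset> D"
    using slot_neighbour[OF B, of "B - N"] by blast
  have "D \<subset> B" using D(2,3) by blast
  then show False using min D(1) by blast
qed

end

text \<open>
  The weight is a solution of the equations given by the members of \<open>F\<close> and by the ground set.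
  The last equation makes the complements of members sum to zero as well, which yields
  the statement about members that contain \<open>P\<close> or \<open>N\<close>.
\<close>
theorem saturated_card_ge:
  assumes sat: "saturated n (multipartite_carrier k ns) multipartite_le F"
    and m: "m \<in> {1..k}" "ns m \<ge> 2"
  shows "n \<le> card F + 1"
proof (rule ccontr)
  let ?I = "{1..n}"
  assume "\<not> n \<le> card F + 1"
  have sub: "F \<subseteq> Pow ?I" using sat by (simp add: saturated_def)
  then have "finite F" by (rule finite_subset) simp
  then have "card (insert ?I F) < card ?I"
    using \<open>\<not> n \<le> card F + 1\<close> 
    by (simp add: card_insert_if)
  then obtain x :: "nat \<Rightarrow> real" where x: "\<exists>i\<in>?I. x i \<noteq> 0"
    and orth: "\<forall>A\<in>insert ?I F. (\<Sum>i\<in>?I. of_bool (i \<in> A) * x i) = 0"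
    using nonzero_solution[of "insert ?I F" ?I "\<lambda>A i. of_bool (i \<in> A)"] \<open>finite F\<close> by auto
  have sum0: "sum x A = 0" if "A \<in> insert ?I F" for A
  proof -
    have "(\<Sum>i\<in>?I. of_bool (i \<in> A) * x i) = sum x (?I \<inter> A)"
      by (simp add: of_bool_def if_distrib[of "\<lambda>c. c * _"] sum.inter_restrict cong: if_cong)
    moreover have "(\<Sum>i\<in>?I. of_bool (i \<in> A) * x i) = 0" using orth that by blast
    moreover have "?I \<inter> A = A" using that sub by auto
    ultimately show ?thesis by metis
  qed
  have finA: "finite A" if "A \<in> insert ?I F" for A
    using that sub by (auto intro: finite_subset)
  define P where "P = {i\<in>?I. 0 < x i}"
  define N where "N = {i\<in>?I. x i < 0}"
  have vanish: "A \<inter> (P \<union> N) = {}"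
    if A: "finite A" "sum x A = 0" "(\<forall>i\<in>A. 0 \<le> x i) \<or> (\<forall>i\<in>A. x i \<le> 0)" for A
  proof -
    have "\<forall>i\<in>A. x i = 0"
      using A(3)
    proof
      assume "\<forall>i\<in>A. 0 \<le> x i"
      then show ?thesis using sum_nonneg_eq_0_iff[of A x] A(1,2) by simp
    next
      assume "\<forall>i\<in>A. x i \<le> 0"
      then show ?thesis using sum_nonneg_eq_0_iff[of A "\<lambda>i. - x i"] A(1,2) by (simp add: sum_negf)
    qed
    then show ?thesis by (auto simp: P_def N_def)
  qed
  have PN: "P \<subseteq> ?I" "N \<subseteq> ?I" by (auto simp: P_def N_def)
  have nonneg: "\<forall>i\<in>A. 0 \<le> x i" if "A \<subseteq> ?I" "A \<inter> N = {}" for A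
  proof
    fix i assume "i \<in> A"
    with that have "i \<in> ?I" "i \<notin> N" by blast+
    then show "0 \<le> x i" by (simp add: N_def)
  qed
  have nonpos: "\<forall>i\<in>A. x i \<le> 0" if "A \<subseteq> ?I" "A \<inter> P = {}" for A
  proof
    fix i assume "i \<in> A"
    with that have "i \<in> ?I" "i \<notin> P" by blast+
    then show "x i \<le> 0" by (simp add: P_def)
  qed
  have zero: "A \<inter> (P \<union> N) = {}" if "A \<subseteq> ?I" "sum x A = 0" "A \<inter> P = {} \<or> A \<inter> N = {}" for A
    by (rule vanish[OF finite_subset[OF that(1)] that(2)]) (use nonneg nonpos that in auto)
  have "?I \<inter> (P \<union> N) \<noteq> {}"
  proof -
    obtain i where "i \<in> ?I" "x i \<noteq> 0" using x by blast
    then have "i \<in> ?I \<inter> (P \<union> N)" by (auto simp: P_def N_def)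
    then show ?thesis by blast
  qed
  then have PN_ne: "P \<noteq> {}" "N \<noteq> {}" using zero[of ?I] sum0[of ?I] by blast+
  have rest: "sum x (?I - A) = 0" if "A \<in> F" for A
  proof -
    have "sum x ?I = sum x (?I - A) + sum x A"
      using that sub by (intro sum.subset_diff) auto
    then show ?thesis using sum0[of ?I] sum0[of A] that by simp
  qed
  have "balanced_saturated n k m ns F P N"
  proof
    show "saturated n (multipartite_carrier k ns) multipartite_le F" "m \<in> {1..k}" "2 \<le> ns m"
      by fact+
    show "P \<subseteq> ?I" "N \<subseteq> ?I" "P \<noteq> {}" "N \<noteq> {}" by fact+
    show "P \<inter> N = {}" by (auto simp: P_def N_def)
  next
    fix A assume A: "A \<in> F" "A \<inter> N = {}"
    then have "A \<subseteq> ?I" "sum x A = 0" using sub sum0[of A] by auto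
    then show "A \<inter> P = {}" using zero[of A] A(2) by blast
  next
    fix A assume A: "A \<in> F"
    show "P \<subseteq> A \<longleftrightarrow> N \<subseteq> A" using zero[OF _ rest[OF A]] PN by blast
  next
    fix A assume A: "A \<in> F" "A \<union> P \<in> F"
    have "finite P" using PN(1) by (rule finite_subset) simp
    have "sum x (A \<union> (P - A)) = sum x A + sum x (P - A)"
      using finA[of A] A \<open>finite P\<close> by (intro sum.union_disjoint) auto
    moreover have "A \<union> (P - A) = A \<union> P" by blast
    moreover have "sum x A = 0" "sum x (A \<union> P) = 0" using sum0 A by auto
    ultimately have "sum x (P - A) = 0" by simp
    moreover have "(P - A) \<inter> N = {}" "P - A \<subseteq> ?I" using PN by (auto simp: P_def N_def)
    ultimately have "(P - A) \<inter> (P \<union> N) = {}" using zero[of "P - A"] by blast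
    then show "P \<subseteq> A" by blast
  qed
  then show False by (rule balanced_saturated.contradiction)
qed

section \<open>A stack-free skeleton that assigns a level to every trace\<close>

lemma saturated_extension:
  assumes "G \<subseteq> Pow {1..n}" "\<nexists>\<Lambda>. stack ns {1..k} G \<Lambda>"
  shows "\<exists>F. saturated n (multipartite_carrier k ns) multipartite_le F \<and> G \<subseteq> F"
proof -
  define \<X> where "\<X> = {F. G \<subseteq> F \<and> F \<subseteq> Pow {1..n} \<and> (\<nexists>\<Lambda>. stack ns {1..k} F \<Lambda>)}"
  have "finite \<X>"
    by (rule finite_subset[of _ "Pow (Pow {1..n})"]) (auto simp: \<X>_def)
  moreover have "G \<in> \<X>" using assms by (simp add: \<X>_def)
  then have "\<X> \<noteq> {}" by blast
  ultimately obtain F where F: "F \<in> \<X>" and max: "\<forall>E\<in>\<X>. F \<subseteq> E \<longrightarrow> F = E"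
    by (rule bexE[OF finite_has_maximal])
  have "\<exists>\<Lambda>. stack ns {1..k} (insert S F) \<Lambda>" if S: "S \<subseteq> {1..n}" "S \<notin> F" for S
  proof (rule ccontr)
    assume "\<nexists>\<Lambda>. stack ns {1..k} (insert S F) \<Lambda>"
    then have "insert S F \<in> \<X>" using F S(1) by (simp add: \<X>_def subset_insertI2)
    then have "F = insert S F" using max subset_insertI by blast
    with S(2) show False by blast
  qed
  with F have "saturated n (multipartite_carrier k ns) multipartite_le F"
    by (simp add: saturated_multipartite_iff \<X>_def)
  with F show ?thesis by (auto simp: \<X>_def)
qed

text \<open>
  If \<open>X\<close> has exactly \<open>c\<close> elements, each \<open>E\<close> adds one point to it, and different \<open>E\<close> add different
  points. If \<open>X\<close> is larger, then it is the only possible \<open>E\<close>.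
\<close>
lemma card_Union_extensions:
  assumes fin: "finite \<E>" "\<E> \<noteq> {}" "\<And>E. E \<in> \<E> \<Longrightarrow> finite E"
    and E: "\<And>E. E \<in> \<E> \<Longrightarrow> X \<subseteq> E" "\<And>E. E \<in> \<E> \<Longrightarrow> card E = Suc c"
    and X: "c \<le> card X"
  shows "c + card \<E> \<le> card (\<Union>\<E>)"
proof -
  obtain E0 where E0: "E0 \<in> \<E>" using fin by blast
  have finU: "finite (\<Union>\<E>)" using fin by blast
  have XU: "X \<subseteq> \<Union>\<E>" using E E0 by blast
  have finX: "finite X" using XU finU by (rule finite_subset)
  show ?thesis
  proof (cases "card X = c")
    case True
    have "\<E> \<subseteq> (\<lambda>v. insert v X) ` (\<Union>\<E> - X)"
    proof
      fix E assume "E \<in> \<E>"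
      have "card (E - X) = 1"
        using card_Diff_subset[OF finX E(1)[OF \<open>E \<in> \<E>\<close>]] E(2)[OF \<open>E \<in> \<E>\<close>] True by simp
      then obtain v where "E - X = {v}" by (auto simp: card_1_singleton_iff)
      then have "E = insert v X" "v \<in> \<Union>\<E> - X" using E(1)[OF \<open>E \<in> \<E>\<close>] \<open>E \<in> \<E>\<close> by blast+
      then show "E \<in> (\<lambda>v. insert v X) ` (\<Union>\<E> - X)" by blast
    qed
    then have "card \<E> \<le> card (\<Union>\<E> - X)"
      using finU by (intro surj_card_le) auto
    then show ?thesis
      using card_Diff_subset[OF finX XU] card_mono[OF finU XU] True by simp
  next
    case False
    have "E = X" if "E \<in> \<E>" for E
      using card_seteq[of E X] fin(3)[OF that] E(1)[OF that] E(2)[OF that] X False by simp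
    then have "\<E> = {X}" using E0 by blast
    then show ?thesis using X False by simp
  qed
qed

locale skeleton =
  fixes k n :: nat and ns :: "nat \<Rightarrow> nat"
  assumes k: "1 \<le> k" and pos: "\<And>i. i \<in> {1..k} \<Longrightarrow> 1 \<le> ns i"
    and large: "k * (\<Sum>j=1..k. ns j) < n"
begin

text \<open>
  Let \<open>1 \<le> i < k\<close>. A set \<open>A \<subseteq> T 0\<close> admits the layers \<open>1,\<dots>,i\<close> inside it when \<open>A \<inter> T i\<close> has at least
  \<open>h i\<close> elements, and otherwise it admits the layers after \<open>i\<close> above \<open>A \<union> R\<close>. Each difference
  \<open>T i - T (Suc i)\<close> with \<open>i < k\<close> has \<open>h k\<close> elements, which leaves room for the points that
  distinguish the members of an upper layer.
\<close>
definition h :: "nat \<Rightarrow> nat" where "h i = (\<Sum>j=1..i. ns j)"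
definition T :: "nat \<Rightarrow> nat set" where "T i = {1..(k - i) * h k}"
definition V :: "nat set" where "V = {1..n}"
definition R :: "nat set" where "R = V - T 0"

text \<open>
  Sets in \<open>low i\<close> and in \<open>up i\<close> are intended for layer \<open>i + 1\<close>. A member of \<open>low i\<close> adds one point
  to a set of \<open>h i\<close> points that holds the previous layers. Dually, a member of \<open>up i\<close> has \<open>h i\<close>
  points in \<open>T i\<close>, so that two of them meet in fewer; if the layer has a single element, there is
  no second set to intersect with and one point less is prescribed.

  The sets \<open>T i\<close> shrink strictly in order to prevent stacks that mix \<open>L\<close> in \<open>low\<close> and \<open>U\<close> in \<open>up\<close>
  within one layer. If all \<open>T i\<close> were equal, then \<open>X \<union> {v}\<close> and \<open>X \<union> R\<close> could together form a layer
  of size two. Here \<open>L\<close> lies within \<open>T (Suc i)\<close>, where \<open>U\<close> has too few points for \<open>L \<inter> U\<close> to hold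
  the previous layers.
\<close>
definition low :: "nat \<Rightarrow> nat set set" where
  "low i = {L. L \<subseteq> T (Suc i) \<and> card L = Suc (h i)}"

definition up :: "nat \<Rightarrow> nat set set" where
  "up i = {U. U \<subseteq> V \<and> V - T i \<subseteq> U \<and> card (U \<inter> T (Suc i)) < h i \<and>
     card (U \<inter> T i) = h i - of_bool (ns (Suc i) = 1)}"

definition Low :: "nat set set" where "Low = (\<Union>i\<in>{i. Suc i < k}. low i)"
definition Up :: "nat set set" where "Up = (\<Union>i\<in>{1..<k}. up i)"

lemma h_0 [simp]: "h 0 = 0" and h_Suc: "h (Suc i) = h i + ns (Suc i)"
  by (simp_all add: h_def)

lemma h_mono: "i \<le> j \<Longrightarrow> h i \<le> h j"
  by (rule lift_Suc_mono_le) (simp add: h_Suc)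

lemma h_Suc_gt: "i < k \<Longrightarrow> Suc (h i) \<le> h (Suc i)"
  using pos[of "Suc i"] by (simp add: h_Suc)

lemma h_strict: "i < j \<Longrightarrow> j \<le> k \<Longrightarrow> h i < h j"
  using h_Suc_gt[of i] h_mono[of "Suc i" j] by simp

lemma T_antimono: "i \<le> j \<Longrightarrow> T j \<subseteq> T i"
  by (auto simp: T_def intro: order_trans[OF _ mult_le_mono1])

lemma T_subset_V: "T i \<subseteq> V"
proof -
  have "(k - i) * h k \<le> k * h k" by (rule mult_le_mono1) simp
  also have "\<dots> < n" using large by (simp add: h_def)
  finally show ?thesis by (auto simp: T_def V_def)
qed

lemma finite_T [simp]: "finite (T i)" and finite_V [simp]: "finite V"
  by (simp_all add: T_def V_def)

lemma card_T_diff: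
  assumes ij: "i < j" "j \<le> k"
  shows "h k \<le> card (T i - T j)"
proof -
  have "card (T i - T j) = card (T i) - card (T j)"
    using T_antimono[of i j] ij by (intro card_Diff_subset) auto
  also have "\<dots> = (k - i) * h k - (k - j) * h k" by (simp add: T_def)
  also have "\<dots> = ((k - i) - (k - j)) * h k" by (rule diff_mult_distrib[symmetric])
  finally have "card (T i - T j) = ((k - i) - (k - j)) * h k" .
  moreover have "1 * h k \<le> ((k - i) - (k - j)) * h k" using ij by (intro mult_le_mono1) simp
  ultimately show ?thesis by simp
qed

lemma R_nonempty: "R \<noteq> {}"
proof -
  have "n \<in> V" "n \<notin> T 0" using large by (auto simp: V_def T_def h_def)
  then show ?thesis by (auto simp: R_def)
qed

lemma V_split: "V = T 0 \<union> R" "T 0 \<inter> R = {}"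
  using T_subset_V by (auto simp: R_def)

lemma lowD: "L \<in> low i \<Longrightarrow> L \<subseteq> T (Suc i)" "L \<in> low i \<Longrightarrow> card L = Suc (h i)"
  "L \<in> low i \<Longrightarrow> finite L"
  by (auto simp: low_def intro: finite_subset)

lemma upD: "U \<in> up i \<Longrightarrow> U \<subseteq> V" "U \<in> up i \<Longrightarrow> V - T i \<subseteq> U" "U \<in> up i \<Longrightarrow> card (U \<inter> T (Suc i)) < h i"
  "U \<in> up i \<Longrightarrow> card (U \<inter> T i) = h i - of_bool (ns (Suc i) = 1)"
  by (auto simp: up_def)

lemma LowE: assumes "L \<in> Low" obtains i where "Suc i < k" "L \<in> low i"
  using assms by (auto simp: Low_def)

lemma UpE: assumes "U \<in> Up" obtains i where "1 \<le> i" "i < k" "U \<in> up i"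
  using assms by (auto simp: Up_def)

lemma Low_subset: "L \<in> Low \<Longrightarrow> L \<subseteq> T 0"
  using lowD(1) T_antimono[of 0] by (elim LowE) blast

lemma R_subset_Up: "U \<in> Up \<Longrightarrow> R \<subseteq> U"
proof (elim UpE)
  fix i assume "U \<in> up i"
  then show "R \<subseteq> U" using upD(2)[of U i] T_antimono[of 0 i] by (auto simp: R_def)
qed

lemma skeleton_subset: "Low \<union> Up \<subseteq> Pow V"
  using Low_subset T_subset_V by (auto elim!: UpE dest: upD(1))

context
  fixes \<Lambda> assumes \<Lambda>: "stack ns {1..k} (Low \<union> Up) \<Lambda>"
begin

definition below :: "nat \<Rightarrow> nat set" where "below i = (\<Union>j\<in>{1..i}. \<Union>(\<Lambda> j))"
definition above :: "nat \<Rightarrow> nat set" where "above i = V \<inter> (\<Inter>j\<in>{i<..k}. \<Inter>(\<Lambda> j))"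

lemma layer_nonempty: "i \<in> {1..k} \<Longrightarrow> \<Lambda> i \<noteq> {}"
  using stackD(2,3)[OF \<Lambda>, of i] pos[of i] by auto

lemma layer_subset: "i \<in> {1..k} \<Longrightarrow> E \<in> \<Lambda> i \<Longrightarrow> E \<subseteq> V"
  using stackD(1)[OF \<Lambda>, of i] skeleton_subset by blast

lemma below_subset: "i < k \<Longrightarrow> E \<in> \<Lambda> (Suc i) \<Longrightarrow> below i \<subseteq> E"
proof -
  assume i: "i < k" "E \<in> \<Lambda> (Suc i)"
  have "x \<subset> E" if "j \<in> {1..i}" "x \<in> \<Lambda> j" for j x
    by (rule stack_psubset[OF \<Lambda> _ _ _ that(2) i(2)]) (use that(1) i in auto)
  then show ?thesis unfolding below_def by blast
qed

lemma subset_above: "i < k \<Longrightarrow> E \<in> \<Lambda> (Suc i) \<Longrightarrow> E \<subseteq> above (Suc i)"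
proof -
  assume i: "i < k" "E \<in> \<Lambda> (Suc i)"
  have "E \<subset> y" if "j \<in> {Suc i<..k}" "y \<in> \<Lambda> j" for j y
    by (rule stack_psubset[OF \<Lambda> _ _ _ i(2) that(2)]) (use that(1) i in auto)
  moreover have "E \<subseteq> V" using layer_subset[of "Suc i" E] i by simp
  ultimately show ?thesis unfolding above_def by blast
qed

lemma below_Suc: "i < k \<Longrightarrow> below (Suc i) = \<Union>(\<Lambda> (Suc i))"
proof -
  assume "i < k"
  then obtain E where "E \<in> \<Lambda> (Suc i)" using layer_nonempty[of "Suc i"] by auto
  have "below (Suc i) = below i \<union> \<Union>(\<Lambda> (Suc i))"
    by (simp add: below_def atLeastAtMostSuc_conv Un_commute)
  then show ?thesis using below_subset[OF \<open>i < k\<close> \<open>E \<in> \<Lambda> (Suc i)\<close>] \<open>E \<in> \<Lambda> (Suc i)\<close> by blast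
qed

lemma above_minus: "i < k \<Longrightarrow> above i = above (Suc i) \<inter> \<Inter>(\<Lambda> (Suc i))"
proof -
  assume "i < k"
  then have "{i<..k} = insert (Suc i) {Suc i<..k}" by auto
  then show ?thesis unfolding above_def by auto
qed

text \<open>
  The previous layers occupy \<open>h i\<close> points, too many for a set of \<open>low j\<close> with \<open>j < i\<close>. The only
  tight case is that \<open>E\<close> equals the union of these layers, which is the single member of layer
  \<open>i\<close>; but \<open>E\<close> contains that member properly.
\<close>
lemma low_index:
  assumes i: "i < k" and E: "E \<in> \<Lambda> (Suc i)" "E \<in> low j" and card: "h i \<le> card (below i)"
  shows "i \<le> j"
proof (rule ccontr)
  assume "\<not> i \<le> j"
  then have ji: "Suc j \<le> i" by simp
  have sub: "below i \<subseteq> E" using below_subset[OF i E(1)] .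
  have cE: "card E = Suc (h j)" and fin: "finite E" using lowD(2,3)[OF E(2)] .
  have "Suc (h j) \<le> h (Suc j)" using h_Suc_gt[of j] ji i by simp
  moreover have "h (Suc j) \<le> h i" using h_mono[OF ji] .
  moreover have "card (below i) \<le> card E" using card_mono[OF fin sub] .
  ultimately have eq: "h (Suc j) = h i" "h (Suc j) = Suc (h j)" "card (below i) = card E"
    using card cE by simp_all
  have "Suc j = i"
    using h_strict[of "Suc j" i] eq(1) ji i by (cases "Suc j = i") auto
  then have "ns i = 1" using eq(2) h_Suc[of j] by simp
  then have "card (\<Lambda> i) = 1" using stackD(3)[OF \<Lambda>, of i] \<open>Suc j = i\<close> i by auto
  then obtain y where y: "\<Lambda> i = {y}" by (auto simp: card_1_singleton_iff)
  have "below i = y" using below_Suc[of j] y \<open>Suc j = i\<close> i by auto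
  moreover have "below i = E" using card_subset_eq[OF fin sub eq(3)] .
  moreover have "y \<subset> E"
    using stack_psubset[OF \<Lambda>, of i "Suc i" y E] y E(1) \<open>Suc j = i\<close> i by auto
  ultimately show False by blast
qed

text \<open>
  Minimality of \<open>h\<close>: a layer whose sets contain \<open>h i\<close> given points and that consists of
  members of \<open>low i\<close> adds at least one point for each of its sets, and a single member of
  a later \<open>low j\<close> is large enough by itself.
\<close>
lemma below_large:
  "i \<le> k \<Longrightarrow> (\<And>j. j \<in> {1..i} \<Longrightarrow> \<Lambda> j \<subseteq> Low) \<Longrightarrow> h i \<le> card (below i) \<and> below i \<subseteq> T i"
proof (induction i)
  case 0
  then show ?case by (simp add: below_def)
next
  case (Suc i)
  have i: "i < k" and IH: "h i \<le> card (below i)" using Suc by auto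
  have in_layer: "Suc i \<in> {1..k}" using i by simp
  note S = stackD(2,3)[OF \<Lambda> in_layer]
  have index: "\<exists>j. i \<le> j \<and> E \<in> low j" if "E \<in> \<Lambda> (Suc i)" for E
  proof -
    have "E \<in> Low" using Suc.prems(2)[of "Suc i"] that by auto
    then show ?thesis using low_index[OF i that _ IH] by (elim LowE) blast
  qed
  have sub: "E \<subseteq> T (Suc i)" if E: "E \<in> \<Lambda> (Suc i)" for E
  proof -
    obtain j where "i \<le> j" "E \<in> low j" using index[OF E] by blast
    then show ?thesis using lowD(1)[of E j] T_antimono[of "Suc i" "Suc j"] by auto
  qed
  have subT: "below (Suc i) \<subseteq> T (Suc i)" using sub unfolding below_Suc[OF i] by blast
  then have fin: "finite (below (Suc i))" by (rule finite_subset) simp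
  have "h (Suc i) \<le> card (below (Suc i))"
  proof (cases "\<exists>E\<in>\<Lambda> (Suc i). \<exists>j>i. E \<in> low j")
    case True
    then obtain E j where E: "E \<in> \<Lambda> (Suc i)" "j > i" "E \<in> low j" by blast
    have "h (Suc i) \<le> card E" using h_mono[of "Suc i" j] E lowD(2)[OF E(3)] by simp
    also have "\<dots> \<le> card (below (Suc i))"
      using E(1) fin unfolding below_Suc[OF i] by (intro card_mono) auto
    finally show ?thesis .
  next
    case False
    have low: "E \<in> low i" if "E \<in> \<Lambda> (Suc i)" for E
      using index[OF that] False that by (metis le_neq_implies_less)
    have "h i + card (\<Lambda> (Suc i)) \<le> card (\<Union>(\<Lambda> (Suc i)))"
      by (rule card_Union_extensions[OF S(1) layer_nonempty[OF in_layer] _ _ _ IH])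
        (use low lowD(2,3) below_subset[OF i] in blast)+
    then show ?thesis using S(2) by (simp add: h_Suc below_Suc[OF i])
  qed
  with subT show ?case by blast
qed

text \<open>
  Dual to \<open>low_index\<close>: a set of \<open>up j\<close> with \<open>i < j\<close> has too many points in \<open>T (Suc i)\<close> to lie
  in the intersection of the later layers, with one tight case if layer \<open>i + 2\<close> is a singleton.
\<close>
lemma up_index:
  assumes i: "i < k" and E: "E \<in> \<Lambda> (Suc i)" "E \<in> up j" "j < k"
    and card: "Suc i < k \<Longrightarrow> card (above (Suc i) \<inter> T (Suc i)) < h (Suc i)"
  shows "j \<le> i"
proof (rule ccontr)
  assume "\<not> j \<le> i"
  then have ij: "Suc i \<le> j" "Suc i < k" using E(3) by auto
  note card = card[OF ij(2)]
  have sub: "E \<subseteq> above (Suc i)" using subset_above[OF i E(1)] .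
  have VE: "V - T j \<subseteq> E" using upD(2)[OF E(2)] .
  show False
  proof (cases "j = Suc i")
    case False
    then have "h (Suc i) \<le> card (T (Suc i) - T j)"
      using card_T_diff[of "Suc i" j] h_mono[of "Suc i" k] ij E(3) by simp
    also have "\<dots> \<le> card (above (Suc i) \<inter> T (Suc i))"
      using VE sub T_subset_V by (intro card_mono) auto
    finally show False using card by simp
  next
    case True
    have "card (E \<inter> T (Suc i)) = h (Suc i) - of_bool (ns (Suc (Suc i)) = 1)"
      using upD(4)[OF E(2)] True by simp
    moreover have le: "E \<inter> T (Suc i) \<subseteq> above (Suc i) \<inter> T (Suc i)" using sub by blast
    then have "card (E \<inter> T (Suc i)) \<le> card (above (Suc i) \<inter> T (Suc i))"
      by (intro card_mono) auto
    ultimately have "ns (Suc (Suc i)) = 1"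
      and eq: "card (E \<inter> T (Suc i)) = card (above (Suc i) \<inter> T (Suc i))"
      using card by (auto split: if_splits simp: of_bool_def)
    then have "card (\<Lambda> (Suc (Suc i))) = 1" using stackD(3)[OF \<Lambda>, of "Suc (Suc i)"] ij by simp
    then obtain y where y: "\<Lambda> (Suc (Suc i)) = {y}" by (auto simp: card_1_singleton_iff)
    have "E \<inter> T (Suc i) = above (Suc i) \<inter> T (Suc i)"
      by (rule card_subset_eq[OF _ le eq]) simp
    moreover have "above (Suc i) \<subseteq> V" by (auto simp: above_def)
    ultimately have "E = above (Suc i)" using sub VE True by blast
    moreover have "E \<subset> y"
      using stack_psubset[OF \<Lambda>, of "Suc i" "Suc (Suc i)" E y] y E(1) ij by simp
    moreover have "y \<subseteq> above (Suc i)"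
      using above_minus[OF ij(2)] subset_above[OF ij(2), of y] y by simp
    ultimately show False by blast
  qed
qed

text \<open>
  Dual to \<open>below_large\<close>: members of \<open>up j\<close> with \<open>j < i\<close> have few points in \<open>T i\<close> by themselves, and
  different members of \<open>up i\<close> have the same points outside \<open>T i\<close>, so they differ inside it.
\<close>
lemma above_small:
  "i < k \<Longrightarrow> (\<And>j. j \<in> {i<..k} \<Longrightarrow> \<Lambda> j \<subseteq> Up) \<Longrightarrow> card (above i \<inter> T i) < h i"
proof (induction "k - i" arbitrary: i rule: less_induct)
  case less
  note i = \<open>i < k\<close>
  have in_layer: "Suc i \<in> {1..k}" using i by simp
  note S = stackD(2,3)[OF \<Lambda> in_layer]
  have IH: "card (above (Suc i) \<inter> T (Suc i)) < h (Suc i)" if "Suc i < k"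
    using less.hyps[of "Suc i"] less.prems that by auto
  have index: "\<exists>j. 1 \<le> j \<and> j \<le> i \<and> E \<in> up j" if "E \<in> \<Lambda> (Suc i)" for E
  proof -
    have "E \<in> Up" using less.prems(2)[of "Suc i"] that i by auto
    then show ?thesis using up_index[OF i that _ _ IH] by (elim UpE) blast
  qed
  have sub: "above i \<inter> T i \<subseteq> E \<inter> T i" if "E \<in> \<Lambda> (Suc i)" for E
    using that unfolding above_minus[OF i] by blast
  obtain E where E: "E \<in> \<Lambda> (Suc i)" using layer_nonempty[OF in_layer] by blast
  show ?case
  proof (cases "\<exists>E\<in>\<Lambda> (Suc i). \<exists>j<i. E \<in> up j")
    case True
    then obtain E j where E: "E \<in> \<Lambda> (Suc i)" "j < i" "E \<in> up j" by blast
    have "card (above i \<inter> T i) \<le> card (E \<inter> T (Suc j))"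
      using sub[OF E(1)] T_antimono[of "Suc j" i] E(2) by (intro card_mono) auto
    also have "\<dots> < h j" using upD(3)[OF E(3)] .
    also have "\<dots> \<le> h i" using h_mono[of j i] E(2) by simp
    finally show ?thesis .
  next
    case False
    have up: "E \<in> up i" if "E \<in> \<Lambda> (Suc i)" for E
      using index[OF that] False that by (metis le_neq_implies_less)
    have "1 \<le> i" using index[OF E] by auto
    then have hi: "h i \<ge> 1" using h_strict[of 0 i] i by simp
    show ?thesis
    proof (cases "ns (Suc i) = 1")
      case True
      have "card (above i \<inter> T i) \<le> card (E \<inter> T i)" using sub[OF E] by (intro card_mono) auto
      then show ?thesis using upD(4)[OF up[OF E]] True hi by simp
    next
      case False
      have "\<exists>D\<in>\<Lambda> (Suc i). D \<noteq> E"
      proof (rule ccontr)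
        assume "\<not> (\<exists>D\<in>\<Lambda> (Suc i). D \<noteq> E)"
        then have "\<Lambda> (Suc i) = {E}" using E by blast
        then show False using S(2) False by simp
      qed
      then obtain D where D: "D \<in> \<Lambda> (Suc i)" "D \<noteq> E" by blast
      show ?thesis
      proof (rule ccontr)
        assume "\<not> card (above i \<inter> T i) < h i"
        then have eq: "above i \<inter> T i = C \<inter> T i" if "C \<in> \<Lambda> (Suc i)" for C
          using upD(4)[OF up[OF that]] False sub[OF that] by (intro card_seteq) auto
        have "C = (C \<inter> T i) \<union> (V - T i)" if "C \<in> \<Lambda> (Suc i)" for C
          using upD(1,2)[OF up[OF that]] by blast
        then have "D = E" using eq D(1) E by blast
        with D(2) show False ..
      qed
    qed
  qed
qed

text \<open>
  Let layer \<open>i + 1\<close> be the first that is not contained in \<open>Low\<close>. As members of \<open>Up\<close> contain the block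
  \<open>R\<close>, all later layers lie in \<open>Up\<close>. If layer \<open>i + 1\<close> lies in \<open>Up\<close>, then the layers up to \<open>i\<close> occupy
  at least \<open>h i\<close> points of \<open>T i\<close>, but must fit into the intersection of the others, which has fewer.
  If it is mixed, the layers up to \<open>i\<close> must fit into \<open>L \<inter> U\<close>, which is too small.
\<close>
lemma no_stack_in_skeleton: False
proof -
  have ex: "\<exists>i. i < k \<and> \<not> \<Lambda> (Suc i) \<subseteq> Low"
  proof (rule ccontr)
    assume "\<not> ?thesis"
    then have "\<Lambda> j \<subseteq> Low" if "j \<in> {1..k}" for j
      using that by (cases j) auto
    moreover obtain i where i: "k = Suc i" using k by (cases k) auto
    moreover obtain E where E: "E \<in> \<Lambda> k" using layer_nonempty[of k] k by auto
    ultimately have "h i \<le> card (below i)" "E \<in> Low" using below_large[of i] by auto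
    then obtain j where "Suc j < k" "E \<in> low j" by (elim LowE)
    then show False using low_index[of i E j] i E \<open>h i \<le> card (below i)\<close> by simp
  qed
  define i where "i = (LEAST i. i < k \<and> \<not> \<Lambda> (Suc i) \<subseteq> Low)"
  have i: "i < k" "\<not> \<Lambda> (Suc i) \<subseteq> Low" using LeastI_ex[OF ex] unfolding i_def by auto
  have before: "\<Lambda> j \<subseteq> Low" if j: "j \<in> {1..i}" for j
  proof -
    obtain l where l: "j = Suc l" using j by (cases j) auto
    then have "\<not> (l < k \<and> \<not> \<Lambda> (Suc l) \<subseteq> Low)"
      using j not_less_Least[of l "\<lambda>i. i < k \<and> \<not> \<Lambda> (Suc i) \<subseteq> Low"] unfolding i_def by simp
    then show ?thesis using l j i by auto
  qed
  have large: "h i \<le> card (below i)" "below i \<subseteq> T i"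
    using below_large[of i] before i by auto
  have layer: "\<Lambda> j \<subseteq> Low \<union> Up" if "j \<in> {1..k}" for j using stackD(1)[OF \<Lambda> that] .
  obtain U where U: "U \<in> \<Lambda> (Suc i)" "U \<in> Up" using i layer[of "Suc i"] by auto
  have after: "\<Lambda> j \<subseteq> Up" if j: "j \<in> {Suc i<..k}" for j
  proof
    fix y assume y: "y \<in> \<Lambda> j"
    have "U \<subset> y"
      by (rule stack_psubset[OF \<Lambda> _ _ _ U(1) y]) (use i j in auto)
    then have "R \<subseteq> y" using R_subset_Up[OF U(2)] by blast
    then have "y \<notin> Low" using Low_subset[of y] V_split(2) R_nonempty by blast
    then show "y \<in> Up" using layer[of j] y j by auto
  qed
  show False
  proof (cases "\<Lambda> (Suc i) \<subseteq> Up")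
    case True
    have "\<Lambda> j \<subseteq> Up" if "j \<in> {i<..k}" for j
      using True after[of j] that by (cases "j = Suc i") auto
    then have small: "card (above i \<inter> T i) < h i" using above_small[OF i(1)] by blast
    obtain E where E: "E \<in> \<Lambda> (Suc i)" using layer_nonempty[of "Suc i"] i by auto
    have "below i \<subseteq> above i"
      using below_subset[OF i(1)] subset_above[OF i(1) E] E unfolding above_minus[OF i(1)] by blast
    then have "card (below i) \<le> card (above i \<inter> T i)"
      using large(2) by (intro card_mono) auto
    then show False using small large(1) by simp
  next
    case False
    then obtain L where L: "L \<in> \<Lambda> (Suc i)" "L \<in> Low" using layer[of "Suc i"] i by auto
    obtain l where l: "L \<in> low l" using L(2) by (elim LowE)
    have "i \<le> l" using low_index[OF i(1) L(1) l large(1)] .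
    then have LT: "L \<subseteq> T (Suc i)" using lowD(1)[OF l] T_antimono[of "Suc i" "Suc l"] by auto
    obtain u where u: "u < k" "U \<in> up u" using U(2) by (elim UpE)
    have "card (above (Suc i) \<inter> T (Suc i)) < h (Suc i)" if "Suc i < k"
      using above_small[OF that] after by blast
    then have "u \<le> i" using up_index[OF i(1) U(1) u(2,1)] by blast
    have "below i \<subseteq> U \<inter> T (Suc u)"
      using below_subset[OF i(1)] L(1) U(1) LT T_antimono[of "Suc u" "Suc i"] \<open>u \<le> i\<close> by blast
    then have "card (below i) \<le> card (U \<inter> T (Suc u))" by (intro card_mono) auto
    also have "\<dots> < h u" using upD(3)[OF u(2)] .
    also have "\<dots> \<le> h i" using h_mono[OF \<open>u \<le> i\<close>] .
    finally show False using large(1) by simp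
  qed
qed

end

text \<open>
  Reserve \<open>h i\<close> points for the lower layers and form the next layer by adding to all of these
  one further point of \<open>C\<close> at a time.
\<close>
lemma low_stack_exists:
  "i < k \<Longrightarrow> C \<subseteq> T i \<Longrightarrow> h i \<le> card C \<Longrightarrow>
     \<exists>\<Lambda>. stack ns {1..i} Low \<Lambda> \<and> (\<forall>j\<in>{1..i}. \<forall>x\<in>\<Lambda> j. x \<subseteq> C)"
proof (induction i arbitrary: C)
  case 0
  show ?case by (auto simp: stack_def)
next
  case (Suc i)
  have fin: "finite C" using Suc.prems(2) by (rule finite_subset) simp
  have "h i \<le> card C" using Suc.prems(3) by (simp add: h_Suc)
  then obtain B where B: "B \<subseteq> C" "card B = h i" "finite B"
    by (rule obtain_subset_with_card_n)
  have "ns (Suc i) \<le> card (C - B)"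
    using card_Diff_subset[OF B(3,1)] B(2) Suc.prems(3) by (simp add: h_Suc)
  then obtain W where W: "W \<subseteq> C - B" "card W = ns (Suc i)" "finite W"
    by (rule obtain_subset_with_card_n)
  have "B \<subseteq> T i" using B(1) Suc.prems(2) T_antimono[of i "Suc i"] by auto
  then obtain \<Lambda> where \<Lambda>: "stack ns {1..i} Low \<Lambda>" "\<forall>j\<in>{1..i}. \<forall>x\<in>\<Lambda> j. x \<subseteq> B"
    using Suc.IH[of B] Suc.prems(1) B(2) by auto
  define \<D> where "\<D> = (\<lambda>v. insert v B) ` W"
  have inj: "inj_on (\<lambda>v. insert v B) W" using W(1) by (auto simp: inj_on_def)
  have "stack ns (insert (Suc i) {1..i}) Low (\<Lambda>(Suc i := \<D>))"
  proof (rule stack_add_layer[OF \<Lambda>(1)])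
    show "\<D> \<subseteq> Low"
    proof
      fix D assume "D \<in> \<D>"
      then obtain v where v: "v \<in> W" "D = insert v B" by (auto simp: \<D>_def)
      then have "D \<subseteq> T (Suc i)" "card D = Suc (h i)"
        using W(1) B Suc.prems(2) by auto
      then show "D \<in> Low" using Suc.prems(1) by (auto simp: Low_def low_def)
    qed
    show "finite \<D>" "card \<D> = ns (Suc i)"
      using W(2,3) inj by (simp_all add: \<D>_def card_image)
    show "sperner \<D>" using W(1) by (auto simp: sperner_def \<D>_def)
    show "x \<subset> d" if "j \<in> {1..i}" "x \<in> \<Lambda> j" "d \<in> \<D>" for j x d
      using \<Lambda>(2) that W(1) unfolding \<D>_def by blast
  qed simp_all
  moreover have "insert (Suc i) {1..i} = {1..Suc i}" by auto
  ultimately have "stack ns {1..Suc i} Low (\<Lambda>(Suc i := \<D>))" by (simp only:)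
  moreover have "\<forall>j\<in>{1..Suc i}. \<forall>x\<in>(\<Lambda>(Suc i := \<D>)) j. x \<subseteq> C"
  proof (intro ballI)
    fix j x assume j: "j \<in> {1..Suc i}" "x \<in> (\<Lambda>(Suc i := \<D>)) j"
    show "x \<subseteq> C"
    proof (cases "j = Suc i")
      case True
      then show ?thesis using j(2) B(1) W(1) by (auto simp: \<D>_def)
    next
      case False
      then have "j \<in> {1..i}" "x \<in> \<Lambda> j" using j by auto
      then have "x \<subseteq> B" using \<Lambda>(2) by blast
      then show ?thesis using B(1) by blast
    qed
  qed
  ultimately show ?case by blast
qed

text \<open>
  Enlarge \<open>A \<inter> T i\<close> to a set \<open>W\<close> of \<open>h i - 1\<close> points. Together with everything outside \<open>T i\<close> it is
  extended by one point at a time from \<open>T i - T (Suc i)\<close>, or taken as it is if the layer is a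
  singleton. The union of the layer has at most \<open>h i - 1\<close> points in \<open>T (Suc i)\<close>, so the
  construction can be repeated above it.
\<close>
lemma up_stack_exists:
  assumes "i \<le> k" "1 \<le> i" "A \<subseteq> T 0" "i < k \<Longrightarrow> card (A \<inter> T i) < h i"
  shows "\<exists>\<Lambda>. stack ns {i<..k} Up \<Lambda> \<and> (\<forall>j\<in>{i<..k}. \<forall>x\<in>\<Lambda> j. A \<union> R \<subseteq> x)"
  using assms
proof (induction i arbitrary: A rule: inc_induct)
  case base
  show ?case by (auto simp: stack_def)
next
  case (step i)
  have ik: "i < k" and i: "1 \<le> i" and small: "card (A \<inter> T i) < h i"
    using step by auto
  have hik: "h (Suc i) \<le> h k" using h_mono[of "Suc i" k] ik by simp
  have TT: "T (Suc i) \<subseteq> T i" "T i \<subseteq> T 0" using T_antimono[of i "Suc i"] T_antimono[of 0 i] by auto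
  have room: "h k \<le> card (T i - T (Suc i))" using card_T_diff[of i "Suc i"] ik by simp
  have "card (T i - T (Suc i)) \<le> card (T i)" by (rule card_mono) auto
  then have "h i - 1 \<le> card (T i)" using room hik by (simp add: h_Suc)
  moreover have "card (A \<inter> T i) \<le> h i - 1" using small by simp
  ultimately obtain W where W: "A \<inter> T i \<subseteq> W" "W \<subseteq> T i" "card W = h i - 1"
    using exists_subset_between[of "A \<inter> T i" "h i - 1" "T i"] finite_T[of i] by blast
  have finW: "finite W" using W(2) by (rule finite_subset) simp
  define B where "B = (V - T i) \<union> W"
  have "\<exists>\<D>. finite \<D> \<and> card \<D> = ns (Suc i) \<and> sperner \<D> \<and>
      (\<forall>D\<in>\<D>. B \<subseteq> D \<and> D \<subseteq> B \<union> (T i - T (Suc i)) \<and> card (D \<inter> T i) = h i - of_bool (ns (Suc i) = 1))"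
  proof (cases "ns (Suc i) = 1")
    case True
    have "B \<inter> T i = W" using W(2) by (auto simp: B_def)
    then show ?thesis
      using True W(3) by (intro exI[of _ "{B}"]) (auto simp: sperner_def)
  next
    case False
    have "card (T i - T (Suc i)) - card W \<le> card (T i - T (Suc i) - W)"
      using finW by (rule diff_card_le_card_Diff)
    then have "ns (Suc i) \<le> card (T i - T (Suc i) - W)"
      using room hik W(3) small by (simp add: h_Suc)
    then obtain Q where Q: "Q \<subseteq> T i - T (Suc i) - W" "card Q = ns (Suc i)" "finite Q"
      by (rule obtain_subset_with_card_n)
    have QB: "Q \<inter> B = {}" using Q(1) by (auto simp: B_def)
    have "card (insert v B \<inter> T i) = h i" if "v \<in> Q" for v
    proof -
      have "insert v B \<inter> T i = insert v W" "v \<notin> W" using that Q(1) W(2) by (auto simp: B_def)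
      then show ?thesis using W(3) finW small by simp
    qed
    moreover have "inj_on (\<lambda>v. insert v B) Q" using QB by (auto simp: inj_on_def)
    ultimately show ?thesis
      using False Q QB
      by (intro exI[of _ "(\<lambda>v. insert v B) ` Q"]) (auto simp: sperner_def card_image)
  qed
  then obtain \<D> where \<D>: "finite \<D>" "card \<D> = ns (Suc i)" "sperner \<D>"
    and all: "\<forall>D\<in>\<D>. B \<subseteq> D \<and> D \<subseteq> B \<union> (T i - T (Suc i)) \<and>
      card (D \<inter> T i) = h i - of_bool (ns (Suc i) = 1)" by blast
  have D: "B \<subseteq> D" "D \<subseteq> B \<union> (T i - T (Suc i))"
    "card (D \<inter> T i) = h i - of_bool (ns (Suc i) = 1)" if "D \<in> \<D>" for D
    using all that by blast+
  \<comment> \<open>Any layers over \<open>A' \<union> R\<close> lie over the new layer, whose added points are outside \<open>T (Suc i)\<close>.\<close>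
  define A' where "A' = T 0 \<inter> ((V - T (Suc i)) \<union> W)"
  have A'R: "A' \<union> R = (V - T (Suc i)) \<union> W"
    using W(2) TT by (auto simp: A'_def R_def)
  have "A' \<inter> T (Suc i) \<subseteq> W" by (auto simp: A'_def)
  then have "card (A' \<inter> T (Suc i)) \<le> card W" by (intro card_mono finW)
  then have "card (A' \<inter> T (Suc i)) < h (Suc i)" using W(3) small by (simp add: h_Suc)
  then obtain \<Lambda> where \<Lambda>: "stack ns {Suc i<..k} Up \<Lambda>" "\<forall>j\<in>{Suc i<..k}. \<forall>x\<in>\<Lambda> j. A' \<union> R \<subseteq> x"
    using step.IH[of A'] by (auto simp: A'_def)
  have "stack ns (insert (Suc i) {Suc i<..k}) Up (\<Lambda>(Suc i := \<D>))"
  proof (rule stack_add_layer[OF \<Lambda>(1) _ _ \<D>])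
    show "\<D> \<subseteq> Up"
    proof
      fix U assume U: "U \<in> \<D>"
      have "U \<inter> T (Suc i) \<subseteq> W" using D(2)[OF U] TT by (auto simp: B_def)
      then have "card (U \<inter> T (Suc i)) \<le> card W" by (intro card_mono finW)
      then have "card (U \<inter> T (Suc i)) < h i" using W(3) small by simp
      moreover have "U \<subseteq> V" using D(2)[OF U] T_subset_V[of i] W(2) by (auto simp: B_def)
      moreover have "V - T i \<subseteq> U" using D(1)[OF U] by (auto simp: B_def)
      ultimately show "U \<in> Up" using D(3)[OF U] i ik by (auto simp: Up_def up_def)
    qed
    show "d \<subset> y" if "j \<in> {Suc i<..k}" "d \<in> \<D>" "y \<in> \<Lambda> j" for j d y
    proof -
      have y: "V - T (Suc i) \<subseteq> y" "W \<subseteq> y" using \<Lambda>(2) that unfolding A'R by blast+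
      have dV: "d \<subseteq> (V - T (Suc i)) \<union> W"
        using D(2)[OF that(2)] T_subset_V[of i] TT by (auto simp: B_def)
      have "d \<noteq> y"
      proof
        assume "d = y"
        then have "T i - T (Suc i) \<subseteq> d \<inter> T i" using y T_subset_V[of i] by blast
        then have "card (T i - T (Suc i)) \<le> card (d \<inter> T i)" by (intro card_mono) auto
        also have "\<dots> \<le> h i" using D(3)[OF that(2)] by simp
        also have "\<dots> < h k" using h_strict[of i k] ik by simp
        finally show False using room by simp
      qed
      then show ?thesis using dV y by blast
    qed
  qed simp_all
  moreover have "insert (Suc i) {Suc i<..k} = {i<..k}" using ik by auto
  ultimately have "stack ns {i<..k} Up (\<Lambda>(Suc i := \<D>))" by (simp only:)
  moreover have "\<forall>j\<in>{i<..k}. \<forall>x\<in>(\<Lambda>(Suc i := \<D>)) j. A \<union> R \<subseteq> x"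
  proof (intro ballI)
    fix j x assume j: "j \<in> {i<..k}" "x \<in> (\<Lambda>(Suc i := \<D>)) j"
    have AB: "A \<union> R \<subseteq> B" using W(1) step.prems(2) T_subset_V TT by (auto simp: B_def R_def)
    show "A \<union> R \<subseteq> x"
    proof (cases "j = Suc i")
      case True
      then show ?thesis using j(2) AB D(1)[of x] by auto
    next
      case False
      then have "j \<in> {Suc i<..k}" "x \<in> \<Lambda> j" using j by auto
      then have "A' \<union> R \<subseteq> x" using \<Lambda>(2) by blast
      moreover have "B \<subseteq> A' \<union> R" unfolding A'R B_def using TT by blast
      ultimately show ?thesis using AB by blast
    qed
  qed
  ultimately show ?case by blast
qed

text \<open>
  The level is one more than the largest \<open>i\<close> for which \<open>A\<close> admits the layers \<open>1,\<dots>,i\<close> inside it.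
\<close>
lemma level_exists:
  assumes A: "A \<subseteq> T 0"
  shows "\<exists>m\<in>{1..k}. (\<exists>\<Lambda>. stack ns {1..<m} Low \<Lambda> \<and> (\<forall>j\<in>{1..<m}. \<forall>x\<in>\<Lambda> j. x \<subseteq> A)) \<and>
    (\<exists>\<Lambda>. stack ns {m<..k} Up \<Lambda> \<and> (\<forall>j\<in>{m<..k}. \<forall>x\<in>\<Lambda> j. A \<union> R \<subseteq> x))"
proof -
  let ?I = "{i. i < k \<and> h i \<le> card (A \<inter> T i)}"
  define i where "i = Max ?I"
  have fin: "finite ?I" by simp
  have "0 \<in> ?I" using k by simp
  then have "i \<in> ?I" unfolding i_def by (intro Max_in fin) blast
  then have i: "i < k" "h i \<le> card (A \<inter> T i)" by auto
  have top: "card (A \<inter> T (Suc i)) < h (Suc i)" if "Suc i < k"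
  proof (rule ccontr)
    assume "\<not> ?thesis"
    then have "Suc i \<in> ?I" using that by simp
    then have "Suc i \<le> i" unfolding i_def by (intro Max_ge fin)
    then show False by simp
  qed
  have eq: "{1..i} = {1..<Suc i}" by auto
  obtain \<Lambda> where \<Lambda>: "stack ns {1..<Suc i} Low \<Lambda>" "\<forall>j\<in>{1..<Suc i}. \<forall>x\<in>\<Lambda> j. x \<subseteq> A \<inter> T i"
    using low_stack_exists[OF i(1) _ i(2)] unfolding eq by blast
  then have "\<exists>\<Lambda>. stack ns {1..<Suc i} Low \<Lambda> \<and> (\<forall>j\<in>{1..<Suc i}. \<forall>x\<in>\<Lambda> j. x \<subseteq> A)" by blast
  moreover have "\<exists>\<Lambda>. stack ns {Suc i<..k} Up \<Lambda> \<and> (\<forall>j\<in>{Suc i<..k}. \<forall>x\<in>\<Lambda> j. A \<union> R \<subseteq> x)"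
    using up_stack_exists[of "Suc i" A] i(1) A top by simp
  moreover have "Suc i \<in> {1..k}" using i(1) by simp
  ultimately show ?thesis by blast
qed

text \<open>
  An antichain of size \<open>ns m\<close> in the fibre would be layer \<open>m\<close> of a stack whose other layers come
  from the skeleton, where \<open>m\<close> is the level of \<open>A\<close>.
\<close>
lemma fibre_sperner_small:
  assumes F: "Low \<union> Up \<subseteq> F" "\<nexists>\<Lambda>. stack ns {1..k} F \<Lambda>" and A: "A \<subseteq> T 0"
    and w: "\<And>i. i \<in> {1..k} \<Longrightarrow> ns i \<le> w"
    and \<S>: "\<S> \<subseteq> F" "finite \<S>" "sperner \<S>"
      "\<And>S. S \<in> \<S> \<Longrightarrow> S \<inter> T 0 = A \<and> S \<subseteq> V \<and> \<not> R \<subseteq> S \<and> S \<inter> R \<noteq> {}"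
  shows "card \<S> \<le> w - 1"
proof (rule ccontr)
  assume "\<not> card \<S> \<le> w - 1"
  obtain m \<Lambda> M where m: "m \<in> {1..k}"
    and \<Lambda>: "stack ns {1..<m} Low \<Lambda>" "\<forall>j\<in>{1..<m}. \<forall>x\<in>\<Lambda> j. x \<subseteq> A"
    and M: "stack ns {m<..k} Up M" "\<forall>j\<in>{m<..k}. \<forall>x\<in>M j. A \<union> R \<subseteq> x"
    using level_exists[OF A] by blast
  have "ns m \<le> card \<S>" using w[OF m] \<open>\<not> card \<S> \<le> w - 1\<close> by simp
  then obtain \<D> where \<D>: "\<D> \<subseteq> \<S>" "card \<D> = ns m" "finite \<D>"
    by (rule obtain_subset_with_card_n)
  have D: "A \<subset> S" "S \<subset> A \<union> R" if "S \<in> \<D>" for S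
    using \<S>(4)[of S] \<D>(1) that V_split by blast+
  have "\<exists>\<Omega>. stack ns {1..k} F \<Omega>"
  proof (rule stack_sandwich[OF _ _ m])
    show "stack ns {1..<m} F \<Lambda>"
      by (rule stack_within[OF \<Lambda>(1)]) (use stackD(1)[OF \<Lambda>(1)] F(1) in blast)
    show "stack ns {m<..k} F M"
      by (rule stack_within[OF M(1)]) (use stackD(1)[OF M(1)] F(1) in blast)
    show "\<D> \<subseteq> F" "finite \<D>" "card \<D> = ns m" using \<D> \<S>(1) by auto
    show "sperner \<D>" using \<S>(3) \<D>(1) unfolding sperner_def by blast
    show "\<D> \<noteq> {}" using \<D>(2) pos[OF m] by auto
    show "x \<subset> d" if "i \<in> {1..<m}" "x \<in> \<Lambda> i" "d \<in> \<D>" for i x d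
      using \<Lambda>(2) D(1)[OF that(3)] that(1,2) by blast
    show "d \<subset> y" if "j \<in> {m<..k}" "d \<in> \<D>" "y \<in> M j" for j d y
      using M(2) D(2)[OF that(2)] that(1,3) by blast
  qed
  with F(2) show False by blast
qed

text \<open>
  Members of equal cardinality form an antichain, so a fibre over a trace has at most \<open>w - 1\<close>
  members of each cardinality. Besides the fibres there are only the sets that do not split \<open>R\<close>,
  two for each trace.
\<close>
lemma saturated_card_le:
  assumes F: "Low \<union> Up \<subseteq> F" "F \<subseteq> Pow V" "\<nexists>\<Lambda>. stack ns {1..k} F \<Lambda>"
    and w: "\<And>i. i \<in> {1..k} \<Longrightarrow> ns i \<le> w"
  shows "card F \<le> 2 ^ (k * h k) * (2 + (n + 1) * (w - 1))"
proof -
  define fibre where "fibre A = {S \<in> F. S \<inter> T 0 = A \<and> \<not> R \<subseteq> S \<and> S \<inter> R \<noteq> {}}" for A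
  have finF: "finite F" using F(2) by (rule finite_subset) simp
  have fibre: "card (fibre A) \<le> (n + 1) * (w - 1)" if A: "A \<subseteq> T 0" for A
  proof -
    have "fibre A \<subseteq> (\<Union>c\<in>{0..n}. {S \<in> fibre A. card S = c})"
    proof
      fix S assume S: "S \<in> fibre A"
      then have "S \<subseteq> V" using F(2) by (auto simp: fibre_def)
      then have "card S \<le> card V" by (intro card_mono) auto
      then show "S \<in> (\<Union>c\<in>{0..n}. {S \<in> fibre A. card S = c})" using S by (auto simp: V_def)
    qed
    moreover have finf: "finite (fibre A)" using finF by (simp add: fibre_def)
    ultimately have "card (fibre A) \<le> card (\<Union>c\<in>{0..n}. {S \<in> fibre A. card S = c})"
      by (intro card_mono) auto
    also have "\<dots> \<le> (\<Sum>c\<in>{0..n}. card {S \<in> fibre A. card S = c})"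
      by (rule card_UN_le) simp
    also have "\<dots> \<le> (\<Sum>c\<in>{0..n}. w - 1)"
    proof (rule sum_mono)
      fix c
      show "card {S \<in> fibre A. card S = c} \<le> w - 1"
      proof (rule fibre_sperner_small[OF F(1,3) A w])
        show "{S \<in> fibre A. card S = c} \<subseteq> F" by (auto simp: fibre_def)
        show "finite {S \<in> fibre A. card S = c}" using finf by simp
        show "S \<inter> T 0 = A \<and> S \<subseteq> V \<and> \<not> R \<subseteq> S \<and> S \<inter> R \<noteq> {}"
          if "S \<in> {S \<in> fibre A. card S = c}" for S
          using that F(2) by (auto simp: fibre_def)
        show "sperner {S \<in> fibre A. card S = c}"
          unfolding sperner_def
        proof (intro ballI impI)
          fix x y
          assume "x \<in> {S \<in> fibre A. card S = c}" "y \<in> {S \<in> fibre A. card S = c}" "x \<subseteq> y"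
          moreover from this have "y \<subseteq> V" using F(2) by (auto simp: fibre_def)
          then have "finite y" by (rule finite_subset) simp
          ultimately show "x = y" by (intro card_subset_eq) auto
        qed
      qed
    qed
    finally show ?thesis by simp
  qed
  have "F \<subseteq> (\<Union>A\<in>Pow (T 0). {A, A \<union> R} \<union> fibre A)"
  proof
    fix S assume S: "S \<in> F"
    then have "S = (S \<inter> T 0) \<union> (S \<inter> R)" using F(2) V_split(1) by blast
    then have "S = S \<inter> T 0 \<or> S = (S \<inter> T 0) \<union> R \<or> (\<not> R \<subseteq> S \<and> S \<inter> R \<noteq> {})" by blast
    then have "S \<in> {S \<inter> T 0, (S \<inter> T 0) \<union> R} \<union> fibre (S \<inter> T 0)"
      using S by (auto simp: fibre_def)
    then show "S \<in> (\<Union>A\<in>Pow (T 0). {A, A \<union> R} \<union> fibre A)"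
      by (intro UN_I[of "S \<inter> T 0"]) simp_all
  qed
  moreover have "finite (\<Union>A\<in>Pow (T 0). {A, A \<union> R} \<union> fibre A)"
    using finF by (auto simp: fibre_def)
  ultimately have "card F \<le> card (\<Union>A\<in>Pow (T 0). {A, A \<union> R} \<union> fibre A)"
    by (intro card_mono)
  also have "\<dots> \<le> (\<Sum>A\<in>Pow (T 0). card ({A, A \<union> R} \<union> fibre A))"
    by (rule card_UN_le) simp
  also have "\<dots> \<le> (\<Sum>A\<in>Pow (T 0). 2 + (n + 1) * (w - 1))"
  proof (rule sum_mono)
    fix A assume "A \<in> Pow (T 0)"
    then have "card (fibre A) \<le> (n + 1) * (w - 1)" using fibre by simp
    moreover have "card {A, A \<union> R} \<le> 2" by (simp add: card_insert_if)
    moreover have "card ({A, A \<union> R} \<union> fibre A) \<le> card {A, A \<union> R} + card (fibre A)"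
      by (rule card_Un_le)
    ultimately show "card ({A, A \<union> R} \<union> fibre A) \<le> 2 + (n + 1) * (w - 1)" by linarith
  qed
  also have "\<dots> = 2 ^ (k * h k) * (2 + (n + 1) * (w - 1))"
    by (simp add: card_Pow T_def)
  finally show ?thesis .
qed

end

lemma sat_star_multipartite_le:
  assumes "1 \<le> k" "\<And>i. i \<in> {1..k} \<Longrightarrow> 1 \<le> ns i" "\<And>i. i \<in> {1..k} \<Longrightarrow> ns i \<le> w"
    and n: "k * (\<Sum>j=1..k. ns j) < n"
  shows "sat_star_multipartite n k ns
    \<le> 2 ^ (k * (\<Sum>j=1..k. ns j)) * (2 + (n + 1) * (w - 1))"
proof -
  interpret skeleton k n ns by standard fact+
  have "\<nexists>\<Lambda>. stack ns {1..k} (Low \<union> Up) \<Lambda>" using no_stack_in_skeleton by blast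
  then obtain F where F: "saturated n (multipartite_carrier k ns) multipartite_le F" "Low \<union> Up \<subseteq> F"
    using saturated_extension[where G = "Low \<union> Up" and n = n and k = k and ns = ns] skeleton_subset unfolding V_def by blast
  have "sat_star_multipartite n k ns \<le> card F"
    unfolding sat_star_def using F(1) by (intro Least_le) blast
  also have "\<dots> \<le> 2 ^ (k * h k) * (2 + (n + 1) * (w - 1))"
    using F assms(3) unfolding saturated_multipartite_iff V_def[symmetric]
    by (intro saturated_card_le) auto
  finally show ?thesis by (simp add: h_def)
qed

section \<open>The growth of the saturation number\<close>

lemma sat_star_multipartite_ge:
  assumes "m \<in> {1..k}" "ns m \<ge> 2"
  shows "n \<le> sat_star_multipartite n k ns + 1"
proof -
  have "(m, 1) \<in> multipartite_carrier k ns"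
    using assms by (simp add: multipartite_carrier_def)
  then have "\<exists>c F. saturated n (multipartite_carrier k ns) multipartite_le F \<and> card F = c"
    using saturated_exists[of "multipartite_carrier k ns" n multipartite_le] by blast
  then obtain F where F: "saturated n (multipartite_carrier k ns) multipartite_le F"
    "card F = sat_star_multipartite n k ns"
    unfolding sat_star_def using LeastI_ex[of "\<lambda>c. \<exists>F. saturated n (multipartite_carrier k ns) multipartite_le F \<and> card F = c"]
    by blast
  then show ?thesis using saturated_card_ge[where ns = ns, OF F(1) assms] F(2) by simp
qed

text \<open>
  The upper bound with \<open>w = 1\<close> is constant in \<open>n\<close>; in the other case it is used with the crude
  bound \<open>w = n\<^sub>1 + \<dots> + n\<^sub>k\<close>.
\<close>
theorem theorem15:
  fixes k :: nat and ns :: "nat \<Rightarrow> nat"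
  assumes "k \<ge> 1" and "\<And>i. i \<in> {1..k} \<Longrightarrow> ns i \<ge> 1"
  shows "((\<forall>i\<in>{1..k}. ns i = 1) \<longrightarrow>
            (\<lambda>n. real (sat_star_multipartite n k ns)) \<in> O(\<lambda>n. 1)) \<and>
         (\<not> (\<forall>i\<in>{1..k}. ns i = 1) \<longrightarrow>
            (\<lambda>n. real (sat_star_multipartite n k ns)) \<in> \<Theta>(\<lambda>n. real n))"
proof (intro conjI impI)
  define K where "K = k * (\<Sum>j=1..k. ns j)"
  have large: "eventually (\<lambda>n. K < n) at_top" by (rule eventually_gt_at_top)
  have upper: "sat_star_multipartite n k ns \<le> 2 ^ K * (2 + (n + 1) * (w - 1))"
    if "K < n" "\<And>i. i \<in> {1..k} \<Longrightarrow> ns i \<le> w" for n w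
    using sat_star_multipartite_le[OF assms that(2)] that(1) by (simp add: K_def)
  {
    assume chain: "\<forall>i\<in>{1..k}. ns i = 1"
    show "(\<lambda>n. real (sat_star_multipartite n k ns)) \<in> O(\<lambda>n. 1)"
    proof (rule bigoI)
      show "eventually (\<lambda>n. norm (real (sat_star_multipartite n k ns)) \<le> real (2 ^ K * 2) * norm (1::real)) at_top"
        using large
      proof eventually_elim
        fix n assume "K < n"
        then have "sat_star_multipartite n k ns \<le> 2 ^ K * 2"
          using upper[of n 1] chain by simp
        then have "real (sat_star_multipartite n k ns) \<le> real (2 ^ K * 2)" by (rule of_nat_mono)
        then show "norm (real (sat_star_multipartite n k ns)) \<le> real (2 ^ K * 2) * norm (1::real)"
          by simp
      qed
    qed
  }
  assume "\<not> (\<forall>i\<in>{1..k}. ns i = 1)"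
  then obtain m where m: "m \<in> {1..k}" "ns m \<noteq> 1" by blast
  then have m2: "ns m \<ge> 2" using assms(2)[of m] by simp
  define w where "w = (\<Sum>j=1..k. ns j)"
  have w: "ns i \<le> w" if "i \<in> {1..k}" for i
    unfolding w_def using that by (intro member_le_sum) auto
  have "(\<lambda>n. real (sat_star_multipartite n k ns)) \<in> O(\<lambda>n. real n)"
  proof (rule bigoI)
    show "eventually (\<lambda>n. norm (real (sat_star_multipartite n k ns))
        \<le> real (2 ^ K * (2 + 2 * w)) * norm (real n)) at_top"
      using large
    proof eventually_elim
      fix n assume n: "K < n"
      have "sat_star_multipartite n k ns \<le> 2 ^ K * (2 + (n + 1) * (w - 1))"
        using upper[OF n w] .
      also have "\<dots> \<le> 2 ^ K * (2 * n + (2 * n) * w)"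
        using n by (intro mult_le_mono2 add_mono mult_le_mono) auto
      also have "\<dots> = 2 ^ K * (2 + 2 * w) * n" by (simp add: algebra_simps)
      finally have "real (sat_star_multipartite n k ns) \<le> real (2 ^ K * (2 + 2 * w) * n)"
        by (rule of_nat_mono)
      then show "norm (real (sat_star_multipartite n k ns)) \<le> real (2 ^ K * (2 + 2 * w)) * norm (real n)"
        by simp
    qed
  qed
  moreover have "(\<lambda>n. real n) \<in> O(\<lambda>n. real (sat_star_multipartite n k ns))"
  proof (rule bigoI)
    show "eventually (\<lambda>n. norm (real n) \<le> 2 * norm (real (sat_star_multipartite n k ns))) at_top"
      using eventually_ge_at_top[of 2]
    proof eventually_elim
      fix n :: nat assume "2 \<le> n"
      then have "n \<le> 2 * sat_star_multipartite n k ns"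
        using sat_star_multipartite_ge[of m k ns n] m(1) m2 by linarith
      then have "real n \<le> real (2 * sat_star_multipartite n k ns)" by (rule of_nat_mono)
      then show "norm (real n) \<le> 2 * norm (real (sat_star_multipartite n k ns))" by simp
    qed
  qed
  ultimately show "(\<lambda>n. real (sat_star_multipartite n k ns)) \<in> \<Theta>(\<lambda>n. real n)"
    by (intro bigthetaI) (simp_all add: bigomega_iff_bigo)
qed

end
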